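(* Let $x\sim\mathcal{N}(\mu,\Sigma)$ be a Gaussian signal in $\mathbb{R}^n$ with known $\mu$ and known covariance matrix $\Sigma$ of rank $k\le n$, and let $\lambda_1,\dots,\lambda_k$ be the (non-zero) eigenvalues of $\Sigma$ with multiplicities. Let $\varepsilon>0$ be the accuracy, $p\in(0,1)$, and let the measurements be subject to white Gaussian noise added after the measurement: a measurement with vector $a_i$ returns $y_i=a_i^{\intercal}x+w_i$ with $w_i\sim\mathcal{N}(0,\sigma^2)$, $\sigma>0$. Then the Info-Greedy Sensing algorithm described in the context returns $\widehat{x}$ satisfying $\|x-\widehat{x}\|_2<\varepsilon$ with probability at least $p$, using at most the following total power $\sum_i\|a_i\|_2^2$: $$P=\sum_{\substack{i=1\\ \lambda_i\neq0}}^{k}\max\left\{0,\left(\frac{\chi_n^2(p)}{\varepsilon^2}-\frac{1}{\lambda_i}\right)\sigma^2\right\}.$$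
   Context: $\chi_n^2(\cdot)$ denotes the quantile function of the chi-squared distribution with $n$ degrees of freedom, and $\|\Sigma\|$ is the largest eigenvalue of the covariance matrix $\Sigma$. The noises $w_i$ are independent of each other and of $x$. The power allocated to a measurement with vector $a_i$ is $\beta_i=\|a_i\|_2^2$. Info-Greedy Sensing algorithm for this model: as long as $\|\Sigma\|>\varepsilon^2/\chi_n^2(p)$, repeat: let $\lambda=\|\Sigma\|$, let $u$ be a unit eigenvector of the current $\Sigma$ for eigenvalue $\lambda$, let $\beta=\left(\frac{\chi_n^2(p)}{\varepsilon^2}-\frac1\lambda\right)\sigma^2$ and $a=\sqrt{\beta}\,u$; measure with $a$ to obtain $y$; update $\mu\leftarrow\mu+\Sigma a(a^{\intercal}\Sigma a+\sigma^2)^{-1}(y-a^{\intercal}\mu)$ and $\Sigma\leftarrow\Sigma-\Sigma a(a^{\intercal}\Sigma a+\sigma^2)^{-1}a^{\intercal}\Sigma$ (both updates computed from the old $\mu,\Sigma$). When $\|\Sigma\|\le\varepsilon^2/\chi_n^2(p)$, return $\widehat{x}=\mu$ (the posterior mean). *)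

theory Defs
  imports "HOL-Probability.Probability" "HOL-Library.While_Combinator"
begin

section \<open>Gaussian random vectors\<close>

definition covariance_matrix :: "real^'n^'n \<Rightarrow> bool" where
  "covariance_matrix S \<longleftrightarrow> transpose S = S \<and> (\<forall>v. 0 \<le> v \<bullet> (S *v v))"

text \<open>The normal law with mean \<open>m\<close> and variance \<open>v\<close>; for variance 0 it is the point mass at \<open>m\<close>.\<close>

definition normal_law :: "real \<Rightarrow> real \<Rightarrow> real measure" where
  "normal_law m v =
     (if v = 0 then return borel m else density lborel (normal_density m (sqrt v)))"

text \<open>A vector is Gaussian with mean \<open>m\<close> and covariance \<open>S\<close> iff every linear functional of it
  is univariate normal with the corresponding mean and variance. Singular \<open>S\<close> are allowed.\<close>

definition gaussian_vector ::
    "'a measure \<Rightarrow> ('a \<Rightarrow> real^'n) \<Rightarrow> real^'n \<Rightarrow> real^'n^'n \<Rightarrow> bool" where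
  "gaussian_vector M x m S \<longleftrightarrow>
     x \<in> borel_measurable M \<and> covariance_matrix S \<and>
     (\<forall>v. distr M borel (\<lambda>\<omega>. v \<bullet> x \<omega>) = normal_law (v \<bullet> m) (v \<bullet> (S *v v)))"

text \<open>Joint independence of the whole family \<open>x, w 0, w 1, \<dots>\<close>, expressed through the generated
  sigma-algebras because \<open>x\<close> and the \<open>w i\<close> take values in different types.\<close>

definition independent_signal_noise ::
    "'a measure \<Rightarrow> ('a \<Rightarrow> real^'n) \<Rightarrow> (nat \<Rightarrow> 'a \<Rightarrow> real) \<Rightarrow> bool" where
  "independent_signal_noise M x w \<longleftrightarrow>
     prob_space.indep_sets M
       (case_option (sets (vimage_algebra (space M) x borel))
          (\<lambda>i. sets (vimage_algebra (space M) (w i) borel)))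
       UNIV"


section \<open>The chi-squared distribution\<close>

text \<open>The law of the sum of squares of \<open>n\<close> independent standard normal variables.\<close>

definition chi_squared :: "nat \<Rightarrow> real measure" where
  "chi_squared n =
     distr (PiM {..<n} (\<lambda>_. density lborel std_normal_density)) borel (\<lambda>z. \<Sum>i<n. (z i)\<^sup>2)"

definition quantile :: "real measure \<Rightarrow> real \<Rightarrow> real" where
  "quantile D p = Inf {t. p \<le> cdf D t}"

abbreviation chi2_quantile :: "nat \<Rightarrow> real \<Rightarrow> real" where
  "chi2_quantile n p \<equiv> quantile (chi_squared n) p"


section \<open>Eigenvalues\<close>

definition eigenspace :: "real^'n^'n \<Rightarrow> real \<Rightarrow> (real^'n) set" where
  "eigenspace S l = {v. S *v v = l *\<^sub>R v}"

definition eigenvalues :: "real^'n^'n \<Rightarrow> real set" where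
  "eigenvalues S = {l. \<exists>v\<in>eigenspace S l. v \<noteq> 0}"

definition max_eigenvalue :: "real^'n^'n \<Rightarrow> real" where
  "max_eigenvalue S = Max (eigenvalues S)"

text \<open>\<open>lam 1, \<dots>, lam k\<close> lists the non-zero eigenvalues of \<open>S\<close>, each as often as its multiplicity.
  (For the symmetric matrices considered here geometric and algebraic multiplicity agree.)\<close>

definition nonzero_eigenvalue_list :: "real^'n^'n \<Rightarrow> nat \<Rightarrow> (nat \<Rightarrow> real) \<Rightarrow> bool" where
  "nonzero_eigenvalue_list S k lam \<longleftrightarrow>
     (\<forall>i\<in>{1..k}. lam i \<noteq> 0) \<and>
     (\<forall>l. l \<noteq> 0 \<longrightarrow> card {i \<in> {1..k}. lam i = l} = dim (eigenspace S l))"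


section \<open>Info-Greedy Sensing with noise added after the measurement\<close>

text \<open>\<open>eigvec i S\<close> is the eigenvector picked for the \<open>i\<close>-th measurement (counting from 0) when the
  current covariance is \<open>S\<close>. The rule is arbitrary, also when the largest eigenvalue is multiple.\<close>

definition eigenvector_rule :: "(nat \<Rightarrow> real^'n^'n \<Rightarrow> real^'n) \<Rightarrow> bool" where
  "eigenvector_rule eigvec \<longleftrightarrow>
     (\<forall>i S. covariance_matrix S \<longrightarrow>
        norm (eigvec i S) = 1 \<and> eigvec i S \<in> eigenspace S (max_eigenvalue S))"

definition measurement_power :: "nat \<Rightarrow> real \<Rightarrow> real \<Rightarrow> real \<Rightarrow> real \<Rightarrow> real" where
  "measurement_power n eps p sd l = (chi2_quantile n p / eps\<^sup>2 - 1 / l) * sd\<^sup>2"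

definition mean_update ::
    "real \<Rightarrow> real^'n \<Rightarrow> real \<Rightarrow> real^'n \<Rightarrow> real^'n^'n \<Rightarrow> real^'n" where
  "mean_update sd a y m S =
     m + ((y - a \<bullet> m) / (a \<bullet> (S *v a) + sd\<^sup>2)) *\<^sub>R (S *v a)"

definition covariance_update :: "real \<Rightarrow> real^'n \<Rightarrow> real^'n^'n \<Rightarrow> real^'n^'n" where
  "covariance_update sd a S =
     S - inverse (a \<bullet> (S *v a) + sd\<^sup>2) *\<^sub>R
       ((columnvector (S *v a) :: real^1^'n) ** rowvector (a v* S))"

text \<open>The state consists of the current mean, the current covariance and the list of the
  measurement vectors used so far. \<open>measure_with i a\<close> is the outcome of the \<open>i\<close>-th measurement
  (counting from 0), taken with vector \<open>a\<close>.\<close>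

definition info_greedy_step ::
    "(nat \<Rightarrow> real^'n^'n \<Rightarrow> real^'n) \<Rightarrow> real \<Rightarrow> real \<Rightarrow> real \<Rightarrow> (nat \<Rightarrow> real^'n \<Rightarrow> real) \<Rightarrow>
     (real^'n) \<times> (real^'n^'n) \<times> (real^'n) list \<Rightarrow> (real^'n) \<times> (real^'n^'n) \<times> (real^'n) list" where
  "info_greedy_step eigvec eps p sd measure_with = (\<lambda>(m, S, as).
     let l = max_eigenvalue S;
         u = eigvec (length as) S;
         b = measurement_power CARD('n) eps p sd l;
         a = sqrt b *\<^sub>R u;
         y = measure_with (length as) a
     in (mean_update sd a y m S, covariance_update sd a S, as @ [a]))"

text \<open>The result is \<open>None\<close> if the loop does not terminate; otherwise it consists of the estimate
  (the final mean), the final covariance and the measurement vectors used.\<close>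

definition info_greedy ::
    "(nat \<Rightarrow> real^'n^'n \<Rightarrow> real^'n) \<Rightarrow> real \<Rightarrow> real \<Rightarrow> real \<Rightarrow> (nat \<Rightarrow> real^'n \<Rightarrow> real) \<Rightarrow>
     real^'n \<Rightarrow> real^'n^'n \<Rightarrow> ((real^'n) \<times> (real^'n^'n) \<times> (real^'n) list) option" where
  "info_greedy eigvec eps p sd measure_with m S =
     while_option
       (\<lambda>(m, S, as). max_eigenvalue S > eps\<^sup>2 / chi2_quantile CARD('n) p)
       (info_greedy_step eigvec eps p sd measure_with)
       (m, S, [])"

end

(* Each measurement lowers the largest eigenvalue l to the threshold t = eps^2 / chi2_quantile n p
   and keeps the eigenvectors, so the eigenvalues above t, counted with multiplicity, bound the
   number of measurements, and the total power telescopes. Covariances and measurement vectors do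
   not depend on the data; hence the error e = x - xhat is affine in x and the noises, and it is
   N(0, S') with S' \<le> t I. Since the law of a Gaussian vector is given through its linear
   functionals, the law of norm e is recovered from them by averaging over an independent Gaussian
   direction, which yields the Laplace transform of (norm e)^2. So e may be replaced by a vector
   sum_b sqrt (mu_b) z_b b with b orthonormal, z_b independent standard normal and mu_b \<le> t, for
   which (norm e)^2 \<le> t * chi^2_n. *)

theory Submission
  imports Defs
begin

section \<open>Eigenvalues of covariance matrices\<close>

text \<open>The power \<open>b\<close> solves \<open>l * sd^2 / (b * l + sd^2) = t\<close>, so one
  measurement along a unit eigenvector for \<open>l\<close> brings that eigenvalue to exactly
  \<open>t\<close>. Eigenvalues are counted strictly above \<open>t\<close> because the multiplicity
  of \<open>t\<close> itself grows with every measurement. The definition of a Gaussian vector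
  through functionals provides neither a density nor a factorisation, so it says nothing directly
  about a norm; this is the obstacle that the random direction removes. It suffices to compare the
  integer moments of \<open>exp (- (norm e)^2)\<close>, since this variable lives in a compact
  interval. Finally, the claim asks for the strict inequality \<open>norm e < eps\<close>, whereas a
  quantile controls a closed half-line; the difference is an atom, and the chi-squared law has
  none.\<close>

lemma covariance_matrix_dot:
  assumes "covariance_matrix S"
  shows "(S *v v) \<bullet> w = v \<bullet> (S *v w)"
  by (metis assms covariance_matrix_def dot_lmul_matrix transpose_matrix_vector)

lemma covariance_matrix_nonneg: "covariance_matrix S \<Longrightarrow> 0 \<le> v \<bullet> (S *v v)"
  by (simp add: covariance_matrix_def)

lemma covariance_matrixI:
  fixes S :: "real^'n^'n"
  assumes "\<And>v w. (S *v v) \<bullet> w = v \<bullet> (S *v w)" and "\<And>v. 0 \<le> v \<bullet> (S *v v)"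
  shows "covariance_matrix S"
proof -
  have "(transpose S *v v) \<bullet> w = (S *v v) \<bullet> w" for v w
    using assms(1) by (simp add: dot_lmul_matrix)
  then have "transpose S *v v = S *v v" for v
    by (metis vector_eq_rdot)
  then have "transpose S = S"
    by (simp add: matrix_eq)
  with assms(2) show ?thesis by (simp add: covariance_matrix_def)
qed

text \<open>A maximiser of the quadratic form on the unit sphere is an eigenvector: with \<open>l\<close> the maximum,
  the semidefinite form of \<open>l I - S\<close> vanishes at it, hence so does its derivative.\<close>

lemma max_quadratic_form_eigenvector:
  fixes S :: "real^'n^'n"
  assumes S: "covariance_matrix S"
  obtains u l where "norm u = 1" "S *v u = l *\<^sub>R u" "\<And>v. v \<bullet> (S *v v) \<le> l * (norm v)\<^sup>2"
proof -
  have "continuous_on (sphere (0::real^'n) 1) (\<lambda>v. v \<bullet> (S *v v))"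
    by (intro continuous_on_inner continuous_on_id matrix_vector_mult_linear_continuous_on)
  moreover have "sphere (0::real^'n) 1 \<noteq> {}" by simp
  ultimately obtain u where "u \<in> sphere 0 1" "\<forall>v\<in>sphere 0 1. v \<bullet> (S *v v) \<le> u \<bullet> (S *v u)"
    using continuous_attains_sup[OF compact_sphere] by blast
  then have u: "norm u = 1" and max: "\<And>v. norm v = 1 \<Longrightarrow> v \<bullet> (S *v v) \<le> u \<bullet> (S *v u)"
    by auto
  define l where "l = u \<bullet> (S *v u)"
  have le: "v \<bullet> (S *v v) \<le> l * (norm v)\<^sup>2" for v
  proof (cases "v = 0")
    case False
    have "((1 / norm v) *\<^sub>R v) \<bullet> (S *v ((1 / norm v) *\<^sub>R v)) \<le> l"
      unfolding l_def by (rule max) (use False in simp)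
    then have "(v \<bullet> (S *v v)) / (norm v)\<^sup>2 \<le> l"
      by (simp add: matrix_vector_mult_scaleR power2_eq_square)
    then show ?thesis using False by (simp add: divide_le_eq)
  qed simp
  define d where "d = l *\<^sub>R u - S *v u"
  have "d \<bullet> d = 0"
  proof (rule ccontr)
    assume "d \<bullet> d \<noteq> 0"
    then have pos: "d \<bullet> d > 0" by (simp add: less_le)
    \<comment> \<open>The right-hand side is the form of \<open>l I - S\<close> at
      \<open>u + s d\<close>: its constant term vanishes by the choice of \<open>l\<close>, and its
      derivative at \<open>s = 0\<close> is \<open>2 * (d \<bullet> d)\<close>.\<close>
    have q: "0 \<le> 2 * s * (d \<bullet> d) + s\<^sup>2 * (l * (norm d)\<^sup>2 - d \<bullet> (S *v d))" for s
    proof -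
      have "(u + s *\<^sub>R d) \<bullet> (S *v (u + s *\<^sub>R d)) \<le> l * (norm (u + s *\<^sub>R d))\<^sup>2"
        by (rule le)
      moreover have "(norm (u + s *\<^sub>R d))\<^sup>2 = 1 + 2 * s * (u \<bullet> d) + s\<^sup>2 * (norm d)\<^sup>2"
        using u unfolding power2_norm_eq_inner
        by (simp add: inner_add norm_eq_1 inner_commute power2_eq_square)
      moreover have "(u + s *\<^sub>R d) \<bullet> (S *v (u + s *\<^sub>R d))
          = l + 2 * s * ((S *v u) \<bullet> d) + s\<^sup>2 * (d \<bullet> (S *v d))"
        by (simp add: matrix_vector_right_distrib matrix_vector_mult_scaleR inner_add l_def
            power2_eq_square covariance_matrix_dot[OF S] inner_commute[of d "S *v u"] distrib_left)
      moreover have "d \<bullet> d = l * (u \<bullet> d) - (S *v u) \<bullet> d"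
        by (subst (1) d_def) (simp add: inner_diff)
      then have "2 * s * (d \<bullet> d) = l * (2 * s * (u \<bullet> d)) - 2 * s * ((S *v u) \<bullet> d)"
        by (simp add: right_diff_distrib ac_simps)
      ultimately show ?thesis by (simp add: distrib_left right_diff_distrib ac_simps)
    qed
    \<comment> \<open>\<open>C\<close> dominates the quadratic coefficient, and the summand 1 keeps
      it positive. The choice \<open>s = - (d \<bullet> d) / C\<close> minimises
      \<open>2 * s * (d \<bullet> d) + s^2 * C\<close>, with the negative value
      \<open>- (d \<bullet> d)^2 / C\<close>.\<close>
    define C where "C = \<bar>l * (norm d)\<^sup>2 - d \<bullet> (S *v d)\<bar> + 1"
    have C: "C > 0" by (simp add: C_def)
    have "0 \<le> 2 * (- (d \<bullet> d) / C) * (d \<bullet> d)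
        + (- (d \<bullet> d) / C)\<^sup>2 * (l * (norm d)\<^sup>2 - d \<bullet> (S *v d))" by (rule q)
    also have "\<dots> \<le> 2 * (- (d \<bullet> d) / C) * (d \<bullet> d) + (- (d \<bullet> d) / C)\<^sup>2 * C"
      by (intro add_left_mono mult_left_mono) (auto simp: C_def)
    also have "\<dots> = - (d \<bullet> d)\<^sup>2 / C"
      using C by (simp add: power2_eq_square field_simps)
    finally show False using pos C by (simp add: divide_le_0_iff field_simps not_less)
  qed
  then have "S *v u = l *\<^sub>R u" by (simp add: d_def)
  with u le that show thesis by blast
qed

section \<open>Eigenspaces and finiteness of the spectrum\<close>

lemma subspace_eigenspace: "subspace (eigenspace S l)"
  by (auto simp: subspace_def eigenspace_def matrix_vector_right_distrib matrix_vector_mult_scaleR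
      scaleR_add_right)

lemma eigenspaces_orthogonal:
  assumes "covariance_matrix S" "v \<in> eigenspace S l" "w \<in> eigenspace S l'" "l \<noteq> l'"
  shows "v \<bullet> w = 0"
  using covariance_matrix_dot[OF assms(1), of v w] assms(2-4) by (simp add: eigenspace_def)

text \<open>One non-zero eigenvector per eigenvalue gives an orthogonal, hence independent, family.
  Finiteness is what gives \<open>Max\<close> in \<open>max_eigenvalue\<close> its meaning.\<close>

lemma finite_eigenvalues:
  fixes S :: "real^'n^'n"
  assumes S: "covariance_matrix S"
  shows "finite (eigenvalues S)"
proof -
  obtain f where f: "\<And>l. l \<in> eigenvalues S \<Longrightarrow> f l \<in> eigenspace S l \<and> f l \<noteq> 0"
    by atomize_elim (rule choice, auto simp: eigenvalues_def)
  have inj: "inj_on f (eigenvalues S)"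
    by (metis S eigenspaces_orthogonal f inj_onI inner_eq_zero_iff)
  have "pairwise orthogonal (f ` eigenvalues S)"
    by (auto simp: pairwise_def orthogonal_def) (metis S eigenspaces_orthogonal f)
  moreover have "0 \<notin> f ` eigenvalues S" using f by force
  ultimately have "finite (f ` eigenvalues S)"
    using pairwise_orthogonal_independent independent_bound by blast
  with inj show ?thesis by (simp add: finite_image_iff)
qed

text \<open>The maximum of the form on the unit sphere is an eigenvalue, and no eigenvalue exceeds
  it, since each is the value of the form at a unit eigenvector.\<close>

lemma quadratic_form_le_max_eigenvalue:
  fixes S :: "real^'n^'n"
  assumes S: "covariance_matrix S"
  shows "v \<bullet> (S *v v) \<le> max_eigenvalue S * (norm v)\<^sup>2"
proof -
  obtain u l where u: "norm u = 1" "S *v u = l *\<^sub>R u"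
    and le: "\<And>v. v \<bullet> (S *v v) \<le> l * (norm v)\<^sup>2"
    using max_quadratic_form_eigenvector[OF S] by blast
  have "u \<noteq> 0" using u by auto
  then have l: "l \<in> eigenvalues S" using u by (auto simp: eigenvalues_def eigenspace_def)
  have "l' \<le> l" if "l' \<in> eigenvalues S" for l'
  proof -
    from that obtain v where v: "v \<noteq> 0" "S *v v = l' *\<^sub>R v"
      by (auto simp: eigenvalues_def eigenspace_def)
    then have "l' * (norm v)\<^sup>2 \<le> l * (norm v)\<^sup>2"
      using le[of v] by (simp add: power2_norm_eq_inner)
    with v show ?thesis by simp
  qed
  then have "max_eigenvalue S = l"
    unfolding max_eigenvalue_def using l by (intro Max_eqI finite_eigenvalues[OF S]) auto
  with le show ?thesis by simp
qed

text \<open>The rank-one change \<open>S - (l - t) u u^T\<close>, which replaces the eigenvalue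
  \<open>l\<close> by \<open>t\<close> in the direction \<open>u\<close>. It is used with the
  accuracy threshold as \<open>t\<close> for a measurement, and with \<open>t = 0\<close> for the
  spectral decomposition. Only the action on vectors is fixed, so that matrices given by different
  formulas fit.\<close>

locale deflation =
  fixes S S' :: "real^'n^'n" and u :: "real^'n" and l t :: real
  assumes S: "covariance_matrix S"
    and u: "norm u = 1" "u \<in> eigenspace S l"
    and t: "0 \<le> t" "t < l"
    and S': "\<And>v. S' *v v = S *v v - ((l - t) * (u \<bullet> v)) *\<^sub>R u"
begin

lemma Su: "S *v u = l *\<^sub>R u"
  using u(2) by (simp add: eigenspace_def)

lemma uu [simp]: "u \<bullet> u = 1"
  using u(1) by (simp add: norm_eq_1)

lemma dot_S: "u \<bullet> (S *v v) = l * (u \<bullet> v)"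
  using covariance_matrix_dot[OF S, of u v] by (simp add: Su)

lemma S'_u: "S' *v u = t *\<^sub>R u"
  by (simp add: S' Su flip: scaleR_diff_left)

lemma covariance_matrix_S': "covariance_matrix S'"
proof (rule covariance_matrixI)
  fix v w show "(S' *v v) \<bullet> w = v \<bullet> (S' *v w)"
    by (simp add: S' inner_diff covariance_matrix_dot[OF S] inner_commute[of v u])
next
  fix v
  \<comment> \<open>The component of \<open>v\<close> orthogonal to \<open>u\<close>: the form of
    \<open>S\<close> at \<open>r\<close> is what remains of the form at \<open>v\<close> after
    removing \<open>l * (u \<bullet> v)^2\<close>.\<close>
  define r where "r = v - (u \<bullet> v) *\<^sub>R u"
  have "0 \<le> r \<bullet> (S *v r)" by (rule covariance_matrix_nonneg[OF S])
  also have "\<dots> = v \<bullet> (S *v v) - l * (u \<bullet> v)\<^sup>2"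
    by (simp add: r_def matrix_vector_mult_diff_distrib matrix_vector_mult_scaleR inner_diff Su dot_S
        power2_eq_square inner_commute[of v u] inner_commute[of "S *v v" u])
  finally have "t * (u \<bullet> v)\<^sup>2 \<le> v \<bullet> (S' *v v)"
    by (simp add: S' inner_diff inner_commute[of v u] power2_eq_square algebra_simps)
  then show "0 \<le> v \<bullet> (S' *v v)"
    using t by (smt (verit) mult_nonneg_nonneg zero_le_power2)
qed

text \<open>\<open>u\<close> is an eigenvector of \<open>S'\<close> for \<open>t\<close>, so
  eigenvectors of \<open>S'\<close> for any other value are orthogonal to \<open>u\<close>; on the
  orthogonal complement of \<open>u\<close> both matrices agree. The value \<open>t\<close> is
  excluded because its eigenspace gains \<open>u\<close>.\<close>

lemma eigenspace_S':
  assumes "l' \<noteq> t"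
  shows "eigenspace S' l' = {v \<in> eigenspace S l'. u \<bullet> v = 0}"
proof -
  have "u \<bullet> v = 0" if "v \<in> eigenspace S' l'" for v
    using eigenspaces_orthogonal[OF covariance_matrix_S', of u t v l'] that assms S'_u
    by (simp add: eigenspace_def)
  moreover have "v \<in> eigenspace S' l' \<longleftrightarrow> v \<in> eigenspace S l'" if "u \<bullet> v = 0" for v
    using that by (simp add: eigenspace_def S')
  ultimately show ?thesis by blast
qed

lemma dim_eigenspace_S':
  assumes "l' \<noteq> t"
  shows "dim (eigenspace S l') = dim (eigenspace S' l') + (if l' = l then 1 else 0)"
proof (cases "l' = l")
  case False
  then have "eigenspace S l' = eigenspace S' l'"
    using eigenspaces_orthogonal[OF S u(2)] by (auto simp: eigenspace_S'[OF assms])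
  with False show ?thesis by simp
next
  case True
  have "span {u} \<subseteq> eigenspace S l"
    using u(2) by (simp add: span_minimal subspace_eigenspace)
  then have "dim {y \<in> eigenspace S l. \<forall>x\<in>span {u}. orthogonal x y} + dim (span {u})
      = dim (eigenspace S l)"
    by (intro dim_subspace_orthogonal_to_vectors subspace_eigenspace subspace_span)
  moreover have "{y \<in> eigenspace S l. \<forall>x\<in>span {u}. orthogonal x y} = eigenspace S' l"
    using True by (auto simp: eigenspace_S'[OF assms[unfolded True]] span_singleton orthogonal_def)
  moreover have "dim (span {u}) = 1"
    using u(1) by (auto simp: dim_span dim_singleton)
  ultimately show ?thesis using True by simp
qed

end

text \<open>The weight \<open>f\<close> is left open for two uses: with the constant 1 the sum
  counts the eigenvalues above \<open>t\<close> and bounds the number of measurements, with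
  \<open>measurement_power\<close> it is the power budget.\<close>

definition excess_sum :: "real \<Rightarrow> (real \<Rightarrow> real) \<Rightarrow> real^'n^'n \<Rightarrow> real" where
  "excess_sum t f S = (\<Sum>l\<in>{l\<in>eigenvalues S. t < l}. real (dim (eigenspace S l)) * f l)"

lemma dim_eigenspace_pos_iff: "0 < dim (eigenspace S l) \<longleftrightarrow> l \<in> eigenvalues S"
proof -
  have "dim (eigenspace S l) = 0 \<longleftrightarrow> l \<notin> eigenvalues S"
    by (auto simp: eigenvalues_def)
  then show ?thesis by (metis gr0I less_numeral_extra(3))
qed

text \<open>Numbers that are not eigenvalues have a zero-dimensional eigenspace and contribute
  nothing, so the sums of two matrices can be taken over a common index set.\<close>

lemma excess_sum_superset:
  assumes "finite A" "{l\<in>eigenvalues S. t < l} \<subseteq> A" "\<And>l. l \<in> A \<Longrightarrow> t < l"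
  shows "excess_sum t f S = (\<Sum>l\<in>A. real (dim (eigenspace S l)) * f l)"
  unfolding excess_sum_def
  by (rule sum.mono_neutral_left) (use assms in \<open>auto simp: dim_eigenspace_pos_iff simp del: dim_eq_0\<close>)

text \<open>Exactly one copy of \<open>l\<close> leaves the range above \<open>t\<close>, and the
  copy of \<open>t\<close> that replaces it is not counted.\<close>

lemma (in deflation) excess_sum_S': "excess_sum t f S = excess_sum t f S' + f l"
proof -
  let ?A = "{k \<in> eigenvalues S. t < k}"
  have fin: "finite ?A" using finite_eigenvalues[OF S] by simp
  have "u \<noteq> 0" using u(1) by auto
  then have l: "l \<in> ?A" using u t by (auto simp: eigenvalues_def)
  have "{k \<in> eigenvalues S'. t < k} \<subseteq> ?A"
    by (auto simp: eigenvalues_def eigenspace_S')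
  then have "excess_sum t f S' = (\<Sum>k\<in>?A. real (dim (eigenspace S' k)) * f k)"
    by (intro excess_sum_superset fin) auto
  moreover have "excess_sum t f S = (\<Sum>k\<in>?A. real (dim (eigenspace S' k)) * f k + (if k = l then f l else 0))"
    unfolding excess_sum_def
    by (intro sum.cong refl) (auto simp: dim_eigenspace_S' algebra_simps)
  ultimately show ?thesis
    using l fin by (simp add: sum.distrib)
qed

lemma excess_sum_nonneg:
  assumes "\<And>l. t < l \<Longrightarrow> 0 \<le> f l"
  shows "0 \<le> excess_sum t f S"
  unfolding excess_sum_def using assms by (intro sum_nonneg) auto

text \<open>Grouping the list by value turns multiplicities into repetitions;
  \<open>0 \<le> t\<close> ensures that the eigenvalues above \<open>t\<close> are non-zero and thus
  listed. The entries up to \<open>t\<close> only add non-negative values of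
  \<open>g\<close>.\<close>

lemma excess_sum_le_eigenvalue_list:
  assumes S: "covariance_matrix S" and lam: "nonzero_eigenvalue_list S k lam"
    and t: "0 \<le> t" "\<And>l. t < l \<Longrightarrow> f l \<le> g l" "\<And>l. 0 \<le> g l"
  shows "excess_sum t f S \<le> (\<Sum>i\<in>{i\<in>{1..k}. lam i \<noteq> 0}. g (lam i))"
proof -
  have nz: "{i\<in>{1..k}. lam i \<noteq> 0} = {1..k}"
    and card: "\<And>l. l \<noteq> 0 \<Longrightarrow> card {i \<in> {1..k}. lam i = l} = dim (eigenspace S l)"
    using lam by (auto simp: nonzero_eigenvalue_list_def)
  let ?A = "{l\<in>eigenvalues S. t < l}"
  have sub: "?A \<subseteq> lam ` {1..k}"
  proof
    fix l assume l: "l \<in> ?A"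
    then have "card {i \<in> {1..k}. lam i = l} > 0"
      using t card[of l] dim_eigenspace_pos_iff[of S l] by simp
    then have "{i \<in> {1..k}. lam i = l} \<noteq> {}" by (metis card.empty less_numeral_extra(3))
    then show "l \<in> lam ` {1..k}" by blast
  qed
  have "excess_sum t f S \<le> (\<Sum>l\<in>?A. real (card {i \<in> {1..k}. lam i = l}) * g l)"
    unfolding excess_sum_def using t card by (intro sum_mono) (auto intro!: mult_left_mono)
  also have "\<dots> \<le> (\<Sum>l\<in>lam ` {1..k}. real (card {i \<in> {1..k}. lam i = l}) * g l)"
    using sub t by (intro sum_mono2) auto
  also have "\<dots> = (\<Sum>i\<in>{1..k}. g (lam i))"
    by (subst sum.image_gen[where g = lam]) auto
  finally show ?thesis unfolding nz .
qed

text \<open>Peeling off the largest eigenvalue strictly enlarges the kernel.\<close>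

lemma spectral_decomposition:
  fixes S :: "real^'n^'n"
  assumes "covariance_matrix S"
  shows "\<exists>B \<mu>. finite B \<and> card B \<le> CARD('n) \<and> pairwise orthogonal B \<and>
    (\<forall>b\<in>B. norm b = 1 \<and> 0 < \<mu> b \<and> b \<in> eigenspace S (\<mu> b)) \<and>
    (\<forall>v. S *v v = (\<Sum>b\<in>B. (\<mu> b * (b \<bullet> v)) *\<^sub>R b))"
proof -
  have "\<exists>B \<mu>. finite B \<and> pairwise orthogonal B \<and>
    (\<forall>b\<in>B. norm b = 1 \<and> 0 < \<mu> b \<and> b \<in> eigenspace S (\<mu> b)) \<and>
    (\<forall>v. S *v v = (\<Sum>b\<in>B. (\<mu> b * (b \<bullet> v)) *\<^sub>R b))"
    using assms
  proof (induction "CARD('n) - dim (eigenspace S 0)" arbitrary: S rule: less_induct)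
    case less
    obtain u l where u: "norm u = 1" "S *v u = l *\<^sub>R u"
      and le: "\<And>v. v \<bullet> (S *v v) \<le> l * (norm v)\<^sup>2"
      using max_quadratic_form_eigenvector[OF less.prems] by blast
    have "0 \<le> l" using covariance_matrix_nonneg[OF less.prems, of u] u by (simp add: norm_eq_1)
    show ?case
    proof (cases "l = 0")
      case True
      have "S *v v = 0" for v
      proof -
        have "w \<bullet> (S *v w) = 0" for w
          using covariance_matrix_nonneg[OF less.prems] le True by (intro antisym) auto
        \<comment> \<open>Polarisation: the form vanishes at \<open>v\<close>, at \<open>S v\<close>
          and at their sum, hence so does the mixed term, which is
          \<open>(S v) \<bullet> (S v)\<close>.\<close>
        from this[of "v + S *v v"] this[of v] this[of "S *v v"]
        have "(S *v v) \<bullet> (S *v v) = 0"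
          by (simp add: matrix_vector_right_distrib inner_add
              covariance_matrix_dot[OF less.prems, of v "S *v v", symmetric])
        then show ?thesis by simp
      qed
      then show ?thesis by (intro exI[of _ "{}"]) (simp add: pairwise_def)
    next
      case False
      \<comment> \<open>Deflation to 0 moves \<open>u\<close> into the kernel, and the old kernel
        stays there because it is orthogonal to \<open>u\<close>.\<close>
      define S' where "S' = S - l *\<^sub>R (\<chi> i j. u $ i * u $ j)"
      have S': "S' *v v = S *v v - (l * (u \<bullet> v)) *\<^sub>R u" for v
        by (simp add: S'_def vec_eq_iff matrix_vector_mult_def inner_vec_def sum_subtractf
            sum_distrib_left sum_distrib_right algebra_simps)
      interpret deflation S S' u l 0
        by standard (use less.prems u False \<open>0 \<le> l\<close> S' in \<open>auto simp: eigenspace_def\<close>)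
      have "u \<notin> eigenspace S 0" using u False by (auto simp: eigenspace_def)
      moreover have "u \<in> eigenspace S' 0" using S'_u by (simp add: eigenspace_def)
      moreover have "eigenspace S 0 \<subseteq> eigenspace S' 0"
      proof
        fix v assume v: "v \<in> eigenspace S 0"
        then have "u \<bullet> v = 0"
          using False by (intro eigenspaces_orthogonal[OF S u(2)]) auto
        with v show "v \<in> eigenspace S' 0" by (simp add: eigenspace_def S')
      qed
      ultimately have "eigenspace S 0 \<subset> eigenspace S' 0" by blast
      then have "dim (eigenspace S 0) < dim (eigenspace S' 0)"
        by (intro dim_psubset) (simp add: span_eq_iff[THEN iffD2] subspace_eigenspace)
      moreover have "dim (eigenspace S' 0) \<le> CARD('n)"
        using dim_subset_UNIV[of "eigenspace S' 0"] by simp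
      ultimately have "CARD('n) - dim (eigenspace S' 0) < CARD('n) - dim (eigenspace S 0)" by simp
      from less.hyps[OF this covariance_matrix_S'] obtain B \<mu> where B: "finite B" "pairwise orthogonal B"
        "\<And>b. b \<in> B \<Longrightarrow> norm b = 1 \<and> 0 < \<mu> b \<and> b \<in> eigenspace S' (\<mu> b)"
        "\<And>v. S' *v v = (\<Sum>b\<in>B. (\<mu> b * (b \<bullet> v)) *\<^sub>R b)"
        by blast
      have orth: "b \<in> eigenspace S (\<mu> b)" "u \<bullet> b = 0" if "b \<in> B" for b
        using B(3)[OF that] eigenspace_S'[of "\<mu> b"] by auto
      have uB: "u \<notin> B" using orth(2)[of u] by auto
      let ?\<mu> = "\<mu>(u := l)"
      show ?thesis
      proof (intro exI[of _ "insert u B"] exI[of _ ?\<mu>] conjI allI ballI)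
        show "finite (insert u B)" using B by simp
        show "pairwise orthogonal (insert u B)"
          using B(2) orth(2) by (auto simp: pairwise_insert orthogonal_def inner_commute)
        fix b assume "b \<in> insert u B"
        then show "norm b = 1" "0 < ?\<mu> b" "b \<in> eigenspace S (?\<mu> b)"
          using B(3) orth uB u Su t by (auto simp: eigenspace_def)
      next
        fix v
        have "(\<Sum>b\<in>B. (?\<mu> b * (b \<bullet> v)) *\<^sub>R b) = S' *v v"
          unfolding B(4) using uB by (intro sum.cong) auto
        then show "S *v v = (\<Sum>b\<in>insert u B. (?\<mu> b * (b \<bullet> v)) *\<^sub>R b)"
          using B(1) uB by (simp add: S')
      qed
    qed
  qed
  then obtain B \<mu> where B: "finite B" "pairwise orthogonal B"
    "\<forall>b\<in>B. norm b = 1 \<and> 0 < \<mu> b \<and> b \<in> eigenspace S (\<mu> b)"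
    "\<forall>v. S *v v = (\<Sum>b\<in>B. (\<mu> b * (b \<bullet> v)) *\<^sub>R b)" by blast
  have "0 \<notin> B" using B(3) by force
  then have "card B \<le> CARD('n)"
    using independent_bound[OF pairwise_orthogonal_independent[OF B(2)]] by simp
  with B show ?thesis by blast
qed

section \<open>The law of the norm is determined by linear functionals\<close>

lemma prob_space_PiM_std_normal:
  "prob_space (PiM I (\<lambda>_. std_normal_distribution))"
  by (intro prob_space_PiM prob_space_normal_density) simp

lemma integral_iexp_PiM_std_normal:
  assumes "finite I"
  shows "(CLINT z|PiM I (\<lambda>_. std_normal_distribution). iexp (\<Sum>i\<in>I. c i * z i))
    = complex_of_real (exp (- (\<Sum>i\<in>I. (c i)\<^sup>2) / 2))"
proof -
  interpret N: real_distribution std_normal_distribution by (rule real_dist_normal_dist)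
  interpret product_sigma_finite "\<lambda>_. std_normal_distribution"
    by (simp add: product_sigma_finite_def N.sigma_finite_measure_axioms)
  have "iexp (\<Sum>i\<in>I. c i * z i) = (\<Prod>i\<in>I. iexp (c i * z i))" for z
    using assms by (simp add: exp_sum sum_distrib_left)
  then have "(CLINT z|PiM I (\<lambda>_. std_normal_distribution). iexp (\<Sum>i\<in>I. c i * z i))
      = (CLINT z|PiM I (\<lambda>_. std_normal_distribution). (\<Prod>i\<in>I. iexp (c i * z i)))"
    by simp
  also have "\<dots> = (\<Prod>i\<in>I. CLINT x|std_normal_distribution. iexp (c i * x))"
    by (intro product_integral_prod assms N.integrable_iexp) auto
  also have "\<dots> = (\<Prod>i\<in>I. complex_of_real (exp (- (c i)\<^sup>2 / 2)))"
    using char_std_normal_distribution by (simp add: char_def fun_eq_iff)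
  also have "\<dots> = complex_of_real (exp (- (\<Sum>i\<in>I. (c i)\<^sup>2) / 2))"
  proof -
    have "exp (- (\<Sum>i\<in>I. (c i)\<^sup>2) / 2) = exp (\<Sum>i\<in>I. - (c i)\<^sup>2 / 2)"
      by (simp add: sum_negf sum_divide_distrib)
    then show ?thesis using assms by (simp only: exp_sum of_real_prod)
  qed
  finally show ?thesis .
qed

text \<open>Fubini with an independent standard Gaussian vector \<open>g\<close>: the average of \<open>iexp (r g \<bullet> x)\<close> over
  \<open>g\<close> is \<open>exp (- r\<^sup>2 (norm x)\<^sup>2 / 2)\<close>, whereas its average over \<open>x\<close> only involves the law of a linear
  functional of \<open>x\<close>.\<close>

lemma (in prob_space) integral_exp_norm_sq:
  fixes X :: "'a \<Rightarrow> real^'n"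
  assumes X: "X \<in> borel_measurable M"
  shows "complex_of_real (\<integral>\<omega>. exp (- (r * norm (X \<omega>))\<^sup>2 / 2) \<partial>M) =
    (CLINT g|PiM (UNIV :: 'n set) (\<lambda>_. std_normal_distribution).
      char (distr M borel (\<lambda>\<omega>. (\<chi> j. g j) \<bullet> X \<omega>)) r)"
proof -
  let ?G = "PiM (UNIV :: 'n set) (\<lambda>_. std_normal_distribution)"
  interpret G: prob_space ?G by (rule prob_space_PiM_std_normal)
  interpret P: pair_prob_space M ?G ..
  note X [measurable]
  have Xj [measurable]: "(\<lambda>\<omega>. X \<omega> $ j) \<in> borel_measurable M" for j
    using borel_measurable_inner[OF X borel_measurable_const[of "axis j 1"]]
    by (simp add: inner_axis)
  have m: "(\<lambda>(\<omega>, g). iexp (r * (\<Sum>j\<in>UNIV. g j * X \<omega> $ j))) \<in> borel_measurable (M \<Otimes>\<^sub>M ?G)"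
    by measurable
  have int: "integrable (M \<Otimes>\<^sub>M ?G) (\<lambda>(\<omega>, g). iexp (r * (\<Sum>j\<in>UNIV. g j * X \<omega> $ j)))"
    by (rule P.integrable_const_bound[where B = 1]) (use m in auto)
  have "complex_of_real (\<integral>\<omega>. exp (- (r * norm (X \<omega>))\<^sup>2 / 2) \<partial>M)
      = (CLINT \<omega>|M. CLINT g|?G. iexp (r * (\<Sum>j\<in>UNIV. g j * X \<omega> $ j)))"
  proof (subst integral_complex_of_real[symmetric], intro Bochner_Integration.integral_cong refl)
    fix \<omega>
    have "(CLINT g|?G. iexp (r * (\<Sum>j\<in>UNIV. g j * X \<omega> $ j)))
        = (CLINT g|?G. iexp (\<Sum>j\<in>UNIV. (r * X \<omega> $ j) * g j))"
      by (simp add: sum_distrib_left ac_simps)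
    also have "\<dots> = complex_of_real (exp (- (\<Sum>j\<in>UNIV. (r * X \<omega> $ j)\<^sup>2) / 2))"
      by (rule integral_iexp_PiM_std_normal) simp
    also have "(\<Sum>j\<in>UNIV. (r * X \<omega> $ j)\<^sup>2) = (r * norm (X \<omega>))\<^sup>2"
      unfolding power_mult_distrib power2_norm_eq_inner
      by (simp add: inner_vec_def sum_distrib_left power2_eq_square)
    finally show "complex_of_real (exp (- (r * norm (X \<omega>))\<^sup>2 / 2))
        = (CLINT g|?G. iexp (r * (\<Sum>j\<in>UNIV. g j * X \<omega> $ j)))" by simp
  qed
  also have "\<dots> = (CLINT g|?G. CLINT \<omega>|M. iexp (r * (\<Sum>j\<in>UNIV. g j * X \<omega> $ j)))"
    using P.Fubini_integral[OF int] by simp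
  also have "\<dots> = (CLINT g|?G. char (distr M borel (\<lambda>\<omega>. (\<chi> j. g j) \<bullet> X \<omega>)) r)"
    by (simp add: char_def integral_distr inner_vec_def)
  finally show ?thesis .
qed

text \<open>On a compact interval a bounded continuous function is uniformly close to a polynomial,
  whose integral is determined by the moments. Applied to cosine and sine this gives equal
  characteristic functions.\<close>

lemma real_distribution_eq_of_moments:
  assumes M: "real_distribution M" "AE x in M. x \<in> {a..b}"
    and N: "real_distribution N" "AE x in N. x \<in> {a..b}"
    and moments: "\<And>k. (\<integral>x. x ^ k \<partial>M) = (\<integral>x. x ^ k \<partial>N)"
  shows "M = N"
proof -
  interpret M: real_distribution M by fact
  interpret N: real_distribution N by fact
  have bnd: "\<bar>x ^ k\<bar> \<le> (\<bar>a\<bar> + \<bar>b\<bar>) ^ k" if "x \<in> {a..b}" for x :: real and k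
    using that by (auto simp: power_abs intro!: power_mono)
  have intM: "integrable M (\<lambda>x. x ^ k)" for k
    using M(2) bnd by (intro M.integrable_const_bound[where B = "(\<bar>a\<bar> + \<bar>b\<bar>) ^ k"]) auto
  have intN: "integrable N (\<lambda>x. x ^ k)" for k
    using N(2) bnd by (intro N.integrable_const_bound[where B = "(\<bar>a\<bar> + \<bar>b\<bar>) ^ k"]) auto
  have eq: "(\<integral>x. f x \<partial>M) = (\<integral>x. f x \<partial>N)"
    if f: "continuous_on UNIV f" "\<And>x. \<bar>f x\<bar> \<le> 1" for f :: "real \<Rightarrow> real"
  proof -
    have fb: "f \<in> borel_measurable borel" using f(1) by (rule borel_measurable_continuous_onI)
    have fM: "integrable M f" and fN: "integrable N f"
      using f(2) fb by (auto intro!: M.integrable_const_bound[where B = 1] N.integrable_const_bound[where B = 1])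
    have "\<bar>(\<integral>x. f x \<partial>M) - (\<integral>x. f x \<partial>N)\<bar> \<le> e" if e: "e > 0" for e
    proof -
      obtain g where g: "real_polynomial_function g" "\<And>x. x \<in> {a..b} \<Longrightarrow> \<bar>f x - g x\<bar> < e / 2"
      proof (rule Stone_Weierstrass_real_polynomial_function[of "{a..b}" f "e / 2"])
        show "continuous_on {a..b} f" using f(1) by (rule continuous_on_subset) simp
      qed (use e in auto)
      then obtain c n where gc: "g = (\<lambda>x. \<Sum>i\<le>n. c i * x ^ i)"
        using real_polynomial_function_iff_sum by blast
      have close: "\<bar>(\<integral>x. f x \<partial>D) - (\<integral>x. g x \<partial>D)\<bar> \<le> e / 2"
        if D: "prob_space D" "AE x in D. x \<in> {a..b}" and int: "integrable D f" "integrable D g" for D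
      proof -
        have "\<bar>\<integral>x. f x - g x \<partial>D\<bar> \<le> (\<integral>x. \<bar>f x - g x\<bar> \<partial>D)" by (rule integral_abs_bound)
        also have "\<dots> \<le> (\<integral>x. e / 2 \<partial>D)"
        proof (rule integral_mono_AE)
          show "AE x in D. \<bar>f x - g x\<bar> \<le> e / 2"
            using D(2) by (rule eventually_mono) (rule less_imp_le[OF g(2)])
        qed (use int prob_space.finite_measure[OF D(1)] in \<open>auto simp: finite_measure.integrable_const\<close>)
        finally show ?thesis using int prob_space.prob_space[OF D(1)] by simp
      qed
      have gM: "integrable M g" and gN: "integrable N g" unfolding gc
        by (intro Bochner_Integration.integrable_sum integrable_mult_right intM intN)+
      have "(\<integral>x. g x \<partial>M) = (\<integral>x. g x \<partial>N)"
        using intM intN moments by (simp add: gc)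
      with close[OF M.prob_space_axioms M(2) fM gM] close[OF N.prob_space_axioms N(2) fN gN]
      show ?thesis by linarith
    qed
    then have "\<bar>(\<integral>x. f x \<partial>M) - (\<integral>x. f x \<partial>N)\<bar> \<le> 0" by (rule dense_ge)
    then show ?thesis by simp
  qed
  have "char M t = char N t" for t
  proof -
    have "(\<integral>x. cos (t * x) \<partial>M) = (\<integral>x. cos (t * x) \<partial>N)"
      and "(\<integral>x. sin (t * x) \<partial>M) = (\<integral>x. sin (t * x) \<partial>N)"
      by (intro eq continuous_intros; simp)+
    moreover have "integrable M (\<lambda>x. iexp (t * x))" "integrable N (\<lambda>x. iexp (t * x))"
      by (auto intro!: M.integrable_iexp N.integrable_iexp)
    ultimately show ?thesis
      unfolding char_def
      by (intro complex_eqI) (simp_all add: Re_exp Im_exp flip: integral_Re integral_Im)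
  qed
  then show ?thesis by (intro Levy_uniqueness M N) auto
qed

lemma norm_less_prob_eq:
  fixes X :: "'a \<Rightarrow> real^'n" and Y :: "'b \<Rightarrow> real^'n"
  assumes M: "prob_space M" "X \<in> borel_measurable M"
    and N: "prob_space N" "Y \<in> borel_measurable N"
    and eq: "\<And>v. distr M borel (\<lambda>\<omega>. v \<bullet> X \<omega>) = distr N borel (\<lambda>\<omega>. v \<bullet> Y \<omega>)"
  shows "measure M {\<omega>\<in>space M. norm (X \<omega>) < c} = measure N {\<omega>\<in>space N. norm (Y \<omega>) < c}"
proof (cases "c > 0")
  case True
  interpret M: prob_space M by fact
  interpret N: prob_space N by fact
  note M(2) [measurable] N(2) [measurable]
  let ?DX = "distr M borel (\<lambda>\<omega>. exp (- (norm (X \<omega>))\<^sup>2))"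
  let ?DY = "distr N borel (\<lambda>\<omega>. exp (- (norm (Y \<omega>))\<^sup>2))"
  have "?DX = ?DY"
  proof (rule real_distribution_eq_of_moments[where a = 0 and b = 1])
    show "real_distribution ?DX" "real_distribution ?DY"
      by (auto intro!: M.real_distribution_distr N.real_distribution_distr)
    show "AE x in ?DX. x \<in> {0..1}" "AE x in ?DY. x \<in> {0..1}"
      by (auto simp: AE_distr_iff)
    fix k
    \<comment> \<open>Chosen so that \<open>r^2 / 2 = k\<close>: the \<open>k\<close>-th moment of
      \<open>exp (- (norm X)^2)\<close> then has the form of the Gaussian average.\<close>
    define r where "r = sqrt (2 * real k)"
    have r: "exp (- (norm (z :: real^'n))\<^sup>2) ^ k = exp (- (r * norm z)\<^sup>2 / 2)" for z
      by (simp add: r_def power_mult_distrib flip: exp_of_nat_mult)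
    have "complex_of_real (\<integral>\<omega>. exp (- (r * norm (X \<omega>))\<^sup>2 / 2) \<partial>M)
        = complex_of_real (\<integral>\<omega>. exp (- (r * norm (Y \<omega>))\<^sup>2 / 2) \<partial>N)"
      unfolding M.integral_exp_norm_sq[OF M(2)] N.integral_exp_norm_sq[OF N(2)] eq ..
    then have "(\<integral>\<omega>. exp (- (r * norm (X \<omega>))\<^sup>2 / 2) \<partial>M)
        = (\<integral>\<omega>. exp (- (r * norm (Y \<omega>))\<^sup>2 / 2) \<partial>N)"
      by (simp only: of_real_eq_iff)
    then show "(\<integral>x. x ^ k \<partial>?DX) = (\<integral>x. x ^ k \<partial>?DY)"
      by (simp add: integral_distr r)
  qed
  \<comment> \<open>As \<open>exp (- s^2)\<close> is strictly decreasing for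
    \<open>s \<ge> 0\<close>, the ball of radius \<open>c\<close> is the preimage of a half-line
    above \<open>exp (- c^2)\<close>.\<close>
  then have "measure ?DX {exp (- c\<^sup>2)<..} = measure ?DY {exp (- c\<^sup>2)<..}" by simp
  moreover have "exp (- c\<^sup>2) < exp (- (norm (z :: real^'n))\<^sup>2) \<longleftrightarrow> norm z < c" for z
    using True by (auto intro: power_strict_mono power2_less_imp_less)
  ultimately show ?thesis
    by (simp add: measure_distr vimage_def Int_def conj_commute)
next
  case False
  then have "\<not> norm z < c" for z :: "real^'n"
    using norm_ge_zero[of z] by linarith
  then show ?thesis by simp
qed

section \<open>Gaussian measurement updates\<close>

lemma normal_law_eq_distr:
  assumes "0 \<le> v"
  shows "normal_law m v = distr std_normal_distribution borel (\<lambda>x. m + sqrt v * x)"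
proof (cases "v = 0")
  case True
  interpret N: real_distribution std_normal_distribution by (rule real_dist_normal_dist)
  show ?thesis using True by (simp add: normal_law_def)
next
  case False
  interpret N: real_distribution std_normal_distribution by (rule real_dist_normal_dist)
  have "distributed std_normal_distribution lborel (\<lambda>x. x) std_normal_density"
    by (auto simp: distributed_def distr_id2)
  from N.normal_density_affine[OF this, of "sqrt v" m] assms False
  have "distributed std_normal_distribution lborel (\<lambda>x. m + sqrt v * x) (normal_density m (sqrt v))"
    by simp
  then have "distr std_normal_distribution lborel (\<lambda>x. m + sqrt v * x)
      = density lborel (normal_density m (sqrt v))"
    by (rule distributed_distr_eq_density)
  then show ?thesis using False by (simp add: normal_law_def cong: distr_cong)
qed

lemma real_distribution_normal_law: "0 \<le> v \<Longrightarrow> real_distribution (normal_law m v)"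
  unfolding normal_law_eq_distr
  by (intro prob_space.real_distribution_distr prob_space_normal_density) auto

lemma char_normal_law:
  assumes "0 \<le> v"
  shows "char (normal_law m v) t = iexp (t * m) * complex_of_real (exp (- (v * t\<^sup>2) / 2))"
proof -
  have "char (normal_law m v) t = (CLINT x|std_normal_distribution. iexp (t * m) * iexp ((t * sqrt v) * x))"
    using assms by (simp add: char_def normal_law_eq_distr integral_distr algebra_simps flip: exp_add)
  also have "\<dots> = iexp (t * m) * char std_normal_distribution (t * sqrt v)"
    by (simp add: char_def)
  finally show ?thesis
    using assms by (simp add: char_std_normal_distribution power_mult_distrib mult.commute)
qed

lemma (in prob_space) distr_eq_normal_lawI:
  assumes "X \<in> borel_measurable M" "0 \<le> v"
    and "\<And>t. char (distr M borel X) t = iexp (t * m) * complex_of_real (exp (- (v * t\<^sup>2) / 2))"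
  shows "distr M borel X = normal_law m v"
  using assms
  by (intro Levy_uniqueness real_distribution_distr real_distribution_normal_law)
    (auto simp: char_normal_law)

lemma (in prob_space) distr_normal_law_scale:
  assumes X [measurable]: "X \<in> borel_measurable M" and v: "0 \<le> v"
    and law: "distr M borel X = normal_law 0 v"
  shows "distr M borel (\<lambda>\<omega>. r * X \<omega>) = normal_law 0 (r\<^sup>2 * v)"
proof (rule distr_eq_normal_lawI)
  fix t
  have "char (distr M borel (\<lambda>\<omega>. r * X \<omega>)) t = char (distr M borel X) (t * r)"
    by (simp add: char_def integral_distr mult.assoc)
  then show "char (distr M borel (\<lambda>\<omega>. r * X \<omega>)) t
      = iexp (t * 0) * complex_of_real (exp (- (r\<^sup>2 * v * t\<^sup>2) / 2))"
    using v by (simp add: law char_normal_law power_mult_distrib ac_simps)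
qed (use v in auto)

lemma (in prob_space) distr_normal_law_add:
  assumes indep: "indep_var borel X borel Y"
    and v: "0 \<le> v" "0 \<le> v'"
    and law: "distr M borel X = normal_law 0 v" "distr M borel Y = normal_law 0 v'"
  shows "distr M borel (\<lambda>\<omega>. X \<omega> + Y \<omega>) = normal_law 0 (v + v')"
proof (rule distr_eq_normal_lawI)
  show "(\<lambda>\<omega>. X \<omega> + Y \<omega>) \<in> borel_measurable M"
    using indep_var_rv1[OF indep] indep_var_rv2[OF indep] by simp
  fix t
  show "char (distr M borel (\<lambda>\<omega>. X \<omega> + Y \<omega>)) t
      = iexp (t * 0) * complex_of_real (exp (- ((v + v') * t\<^sup>2) / 2))"
    using v unfolding char_distr_add[OF indep] law
    by (simp add: char_normal_law add_divide_distrib distrib_right flip: exp_add of_real_mult)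
qed (use v in auto)

text \<open>By symmetry \<open>a v* S\<close> equals \<open>S *v a\<close>, so the subtracted matrix
  is a multiple of the outer product of \<open>S *v a\<close> with itself.\<close>

lemma covariance_update_mult_vec:
  fixes S :: "real^'n^'n"
  assumes S: "covariance_matrix S"
  shows "covariance_update sd a S *v v
    = S *v v - (((S *v a) \<bullet> v) / (a \<bullet> (S *v a) + sd\<^sup>2)) *\<^sub>R (S *v a)"
proof -
  have "a v* S = S *v a"
    using S by (metis covariance_matrix_def transpose_matrix_vector)
  then have "((columnvector (S *v a) :: real^1^'n) ** rowvector (a v* S)) *v v
      = ((S *v a) \<bullet> v) *\<^sub>R (S *v a)"
    by (simp add: vec_eq_iff matrix_vector_mult_def matrix_matrix_mult_def columnvector_def
        rowvector_def inner_vec_def sum_distrib_left sum_distrib_right ac_simps)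
  then show ?thesis
    by (simp add: covariance_update_def matrix_vector_mult_diff_rdistrib
        divide_inverse ac_simps flip: scaleR_matrix_vector_assoc)
qed

text \<open>The right-hand side is the variance of \<open>v \<bullet> e'\<close>, where \<open>e' = e - (a \<bullet> e + w) K\<close> is the estimation
  error after the measurement and \<open>K\<close> the gain vector.\<close>

lemma covariance_update_quadratic_form:
  fixes S :: "real^'n^'n"
  assumes S: "covariance_matrix S" and sd: "sd > 0"
    and r: "r = (v \<bullet> (S *v a)) / (a \<bullet> (S *v a) + sd\<^sup>2)"
  shows "v \<bullet> (covariance_update sd a S *v v)
    = (v - r *\<^sub>R a) \<bullet> (S *v (v - r *\<^sub>R a)) + r\<^sup>2 * sd\<^sup>2"
proof -
  define q D where "q = v \<bullet> (S *v a)" and "D = a \<bullet> (S *v a) + sd\<^sup>2"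
  have D: "D > 0" using covariance_matrix_nonneg[OF S, of a] sd by (simp add: D_def add_nonneg_pos)
  have comm: "a \<bullet> (S *v v) = q" "(S *v a) \<bullet> v = q"
    using covariance_matrix_dot[OF S, of v a] by (simp_all add: q_def inner_commute)
  \<comment> \<open>Since \<open>r = q / D\<close>, the terms \<open>- 2 * r * q + r^2 * D\<close>
    collapse to \<open>- q^2 / D\<close>, the variance reduction of the update.\<close>
  have "(v - r *\<^sub>R a) \<bullet> (S *v (v - r *\<^sub>R a)) + r\<^sup>2 * sd\<^sup>2 = v \<bullet> (S *v v) - 2 * r * q + r\<^sup>2 * D"
    by (simp add: matrix_vector_mult_diff_distrib matrix_vector_mult_scaleR inner_diff comm
        flip: q_def) (simp add: D_def power2_eq_square algebra_simps)
  also have "\<dots> = v \<bullet> (S *v v) - q\<^sup>2 / D"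
  proof -
    have "r = q / D" by (simp add: r q_def D_def)
    then show ?thesis using D by (simp add: power2_eq_square)
  qed
  also have "\<dots> = v \<bullet> (covariance_update sd a S *v v)"
    by (simp add: covariance_update_mult_vec[OF S] inner_diff comm power2_eq_square D_def
        flip: q_def)
  finally show ?thesis by simp
qed

lemma covariance_matrix_update:
  fixes S :: "real^'n^'n"
  assumes S: "covariance_matrix S" and sd: "sd > 0"
  shows "covariance_matrix (covariance_update sd a S)"
proof (rule covariance_matrixI)
  fix v w
  show "(covariance_update sd a S *v v) \<bullet> w = v \<bullet> (covariance_update sd a S *v w)"
    by (simp add: covariance_update_mult_vec[OF S] inner_diff covariance_matrix_dot[OF S]
        inner_commute[of _ w] inner_commute[of v])
next
  fix v
  show "0 \<le> v \<bullet> (covariance_update sd a S *v v)"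
    unfolding covariance_update_quadratic_form[OF S sd refl]
    by (intro add_nonneg_nonneg covariance_matrix_nonneg[OF S]) simp
qed

text \<open>A functional \<open>v\<close> of the new error equals
  \<open>- r * w + (v - r a) \<bullet> e\<close>, a sum of independent centred normals whose
  variances add up to the updated quadratic form.\<close>

lemma (in prob_space) gaussian_vector_measurement_error:
  fixes e :: "'a \<Rightarrow> real^'n"
  assumes e: "gaussian_vector M e 0 S" and sd: "sd > 0"
    and w: "distr M borel w = normal_law 0 (sd\<^sup>2)"
    and indep: "\<And>v. indep_var borel w borel (\<lambda>\<omega>. v \<bullet> e \<omega>)"
  shows "gaussian_vector M
    (\<lambda>\<omega>. e \<omega> - ((a \<bullet> e \<omega> + w \<omega>) / (a \<bullet> (S *v a) + sd\<^sup>2)) *\<^sub>R (S *v a)) 0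
    (covariance_update sd a S)"
proof -
  have S: "covariance_matrix S" and em [measurable]: "e \<in> borel_measurable M"
    and law: "\<And>v. distr M borel (\<lambda>\<omega>. v \<bullet> e \<omega>) = normal_law 0 (v \<bullet> (S *v v))"
    using e by (auto simp: gaussian_vector_def)
  have wm [measurable]: "w \<in> borel_measurable M" using indep_var_rv1[OF indep] .
  show ?thesis
    unfolding gaussian_vector_def
  proof (intro conjI allI covariance_matrix_update S sd)
    show "(\<lambda>\<omega>. e \<omega> - ((a \<bullet> e \<omega> + w \<omega>) / (a \<bullet> (S *v a) + sd\<^sup>2)) *\<^sub>R (S *v a)) \<in> borel_measurable M"
      by measurable
    fix v
    define r where "r = (v \<bullet> (S *v a)) / (a \<bullet> (S *v a) + sd\<^sup>2)"
    have "v \<bullet> (e \<omega> - ((a \<bullet> e \<omega> + w \<omega>) / (a \<bullet> (S *v a) + sd\<^sup>2)) *\<^sub>R (S *v a))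
        = (- r) * w \<omega> + (v - r *\<^sub>R a) \<bullet> e \<omega>" for \<omega>
      by (simp add: r_def inner_diff add_divide_distrib algebra_simps)
    moreover have "distr M borel (\<lambda>\<omega>. (- r) * w \<omega> + (v - r *\<^sub>R a) \<bullet> e \<omega>)
        = normal_law 0 ((- r)\<^sup>2 * sd\<^sup>2 + (v - r *\<^sub>R a) \<bullet> (S *v (v - r *\<^sub>R a)))"
    proof (rule distr_normal_law_add)
      show "indep_var borel (\<lambda>\<omega>. (- r) * w \<omega>) borel (\<lambda>\<omega>. (v - r *\<^sub>R a) \<bullet> e \<omega>)"
      proof -
        have "indep_var borel ((\<lambda>y. (- r) * y) \<circ> w) borel ((\<lambda>y. y) \<circ> (\<lambda>\<omega>. (v - r *\<^sub>R a) \<bullet> e \<omega>))"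
          by (rule indep_var_compose[OF indep]) measurable
        then show ?thesis by (simp only: comp_def)
      qed
      show "distr M borel (\<lambda>\<omega>. (- r) * w \<omega>) = normal_law 0 ((- r)\<^sup>2 * sd\<^sup>2)"
        by (rule distr_normal_law_scale[OF wm _ w]) simp
    qed (auto intro: law covariance_matrix_nonneg[OF S])
    ultimately show "distr M borel (\<lambda>\<omega>. v \<bullet> (e \<omega> - ((a \<bullet> e \<omega> + w \<omega>) / (a \<bullet> (S *v a) + sd\<^sup>2)) *\<^sub>R (S *v a)))
        = normal_law (v \<bullet> 0) (v \<bullet> (covariance_update sd a S *v v))"
      using covariance_update_quadratic_form[OF S sd r_def] by (simp add: add.commute)
  qed
qed

lemma (in prob_space) indep_affine_combination:
  fixes x :: "'a \<Rightarrow> real^'n"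
  assumes x: "x \<in> borel_measurable M" and w: "\<And>i. w i \<in> borel_measurable M"
    and indep: "independent_signal_noise M x w"
  shows "indep_var borel (w i) borel (\<lambda>\<omega>. d + q \<bullet> x \<omega> + (\<Sum>j<i. c j * w j \<omega>))"
proof -
  \<comment> \<open>\<open>None\<close> stands for the signal, which also absorbs the constant
    \<open>d\<close>; noise \<open>i\<close> stays unscaled because it is the variable to be
    separated from the rest.\<close>
  let ?X = "case_option (\<lambda>\<omega>. d + q \<bullet> x \<omega>) (\<lambda>j \<omega>. if j = i then w j \<omega> else c j * w j \<omega>)"
  have X: "?X k \<in> borel_measurable (case k of None \<Rightarrow> vimage_algebra (space M) x borel
      | Some j \<Rightarrow> vimage_algebra (space M) (w j) borel)" for k
  proof (cases k)
    case None
    have [measurable]: "x \<in> measurable (vimage_algebra (space M) x borel) borel"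
      by (rule measurable_vimage_algebra1) simp
    show ?thesis using None by simp
  next
    case (Some j)
    have [measurable]: "w j \<in> measurable (vimage_algebra (space M) (w j) borel) borel"
      by (rule measurable_vimage_algebra1) simp
    show ?thesis using Some by simp
  qed
  have "indep_vars (\<lambda>_. borel) ?X UNIV"
    unfolding indep_vars_def2
  proof (intro conjI ballI)
    fix k show "random_variable borel (?X k)"
      using x w by (cases k) auto
  next
    from indep have "indep_sets (case_option (sets (vimage_algebra (space M) x borel))
          (\<lambda>i. sets (vimage_algebra (space M) (w i) borel))) UNIV"
      by (simp add: independent_signal_noise_def)
    then show "indep_sets (\<lambda>k. {?X k -` A \<inter> space M |A. A \<in> sets borel}) UNIV"
    proof (rule indep_sets_mono_sets)
      fix k
      show "{?X k -` A \<inter> space M |A. A \<in> sets borel}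
          \<subseteq> (case k of None \<Rightarrow> sets (vimage_algebra (space M) x borel)
            | Some i \<Rightarrow> sets (vimage_algebra (space M) (w i) borel))"
        using measurable_sets[OF X[of k]] by (cases k) auto
    qed
  qed
  \<comment> \<open>The subfamily keeps noise \<open>i\<close>, the signal and the earlier noises;
    the sum over all members but noise \<open>i\<close> is independent of it.\<close>
  then have "indep_vars (\<lambda>_. borel) ?X (insert (Some i) (insert None (Some ` {..<i})))"
    by (rule indep_vars_subset) simp
  then have "indep_var borel (?X (Some i)) borel
      (\<lambda>\<omega>. \<Sum>k\<in>insert None (Some ` {..<i}). ?X k \<omega>)"
    by (intro indep_vars_sum) auto
  moreover have "(\<Sum>k\<in>insert None (Some ` {..<i}). ?X k \<omega>) = d + q \<bullet> x \<omega> + (\<Sum>j<i. c j * w j \<omega>)" for \<omega>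
    by (subst sum.insert) (auto simp: sum.reindex intro!: sum.cong)
  ultimately show ?thesis by simp
qed

section \<open>Comparison with the chi-squared distribution\<close>

lemma real_distribution_chi_squared: "real_distribution (chi_squared n)"
proof -
  interpret prob_space "PiM {..<n} (\<lambda>_. std_normal_distribution)"
    by (rule prob_space_PiM_std_normal)
  show ?thesis unfolding chi_squared_def by (intro real_distribution_distr) measurable
qed

lemma emeasure_chi_squared:
  assumes [measurable]: "A \<in> sets borel"
  shows "emeasure (chi_squared n) A
    = (\<integral>\<^sup>+z. indicator A (\<Sum>i<n. (z i)\<^sup>2) \<partial>PiM {..<n} (\<lambda>_. std_normal_distribution))"
proof -
  have [measurable]: "(\<lambda>z. \<Sum>i<n. (z i)\<^sup>2) \<in> borel_measurable (PiM {..<n} (\<lambda>_. std_normal_distribution))"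
    by measurable
  have "emeasure (chi_squared n) A = (\<integral>\<^sup>+x. indicator A x \<partial>chi_squared n)"
    by (simp add: chi_squared_def)
  also have "\<dots> = (\<integral>\<^sup>+z. indicator A (\<Sum>i<n. (z i)\<^sup>2) \<partial>PiM {..<n} (\<lambda>_. std_normal_distribution))"
    unfolding chi_squared_def by (rule nn_integral_distr) measurable
  finally show ?thesis .
qed

text \<open>With all coordinates but the last one fixed, at most two values of the last one reach
  the sum \<open>t\<close>, and these form a null set.\<close>

lemma chi_squared_no_atom:
  assumes "0 < n"
  shows "emeasure (chi_squared n) {t} = 0"
proof -
  interpret N: real_distribution std_normal_distribution by (rule real_dist_normal_dist)
  interpret product_sigma_finite "\<lambda>_::nat. std_normal_distribution"
    by (simp add: product_sigma_finite_def N.sigma_finite_measure_axioms)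
  obtain k where n: "n = Suc k" using assms gr0_implies_Suc by blast
  let ?s = "\<lambda>z. \<Sum>i<k. (z i)\<^sup>2 :: real"
  have null: "emeasure std_normal_distribution {y. s + y\<^sup>2 = t} = 0" for s
  proof -
    have "{y. s + y\<^sup>2 = t} \<subseteq> {sqrt (t - s), - sqrt (t - s)}"
      by (auto simp: real_sqrt_abs eq_diff_eq add.commute)
    then have "finite {y. s + y\<^sup>2 = t}" by (rule finite_subset) simp
    then have "{y. s + y\<^sup>2 = t} \<in> null_sets lborel"
      by (intro finite_imp_null_set_lborel)
    then have "{y. s + y\<^sup>2 = t} \<in> null_sets std_normal_distribution"
      using absolutely_continuousI_density[of "\<lambda>x. ennreal (std_normal_density x)" lborel]
      by (auto simp: absolutely_continuous_def)
    then show ?thesis by (rule null_setsD1)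
  qed
  have "emeasure (chi_squared n) {t}
      = (\<integral>\<^sup>+x. \<integral>\<^sup>+y. indicator {t} (\<Sum>i<Suc k. ((x(k := y)) i)\<^sup>2) \<partial>std_normal_distribution
          \<partial>PiM {..<k} (\<lambda>_. std_normal_distribution))"
    unfolding n emeasure_chi_squared[OF borel_singleton[OF sets.empty_sets]] lessThan_Suc[of k]
    by (rule product_nn_integral_insert) (simp_all del: sum.lessThan_Suc)
  also have "\<dots> = (\<integral>\<^sup>+x. \<integral>\<^sup>+y. indicator {y. ?s x + y\<^sup>2 = t} y \<partial>std_normal_distribution
          \<partial>PiM {..<k} (\<lambda>_. std_normal_distribution))"
    by (intro nn_integral_cong) (auto simp: indicator_def)
  also have "\<dots> = 0"
  proof -
    have "(\<integral>\<^sup>+y. indicator {y. ?s x + y\<^sup>2 = t} y \<partial>std_normal_distribution) = 0" for x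
      using null[of "?s x"] by (subst nn_integral_indicator) auto
    then show ?thesis by simp
  qed
  finally show ?thesis .
qed

text \<open>Right-continuity of the distribution function carries the bound from points above the
  infimum to the infimum itself; \<open>0 < p < 1\<close> makes the set non-empty and bounded
  below.\<close>

lemma (in real_distribution) le_cdf_quantile:
  assumes p: "0 < p" "p < 1"
  shows "p \<le> cdf M (quantile M p)"
proof -
  let ?Q = "{t. p \<le> cdf M t}"
  have "eventually (\<lambda>t. p < cdf M t) at_top"
    using cdf_lim_at_top_prob p(2) by (rule order_tendstoD)
  then obtain t where "p < cdf M t" by (auto simp: eventually_at_top_linorder)
  then have ne: "?Q \<noteq> {}" by (auto intro: less_imp_le)
  have "eventually (\<lambda>t. cdf M t < p) at_bot"
    using cdf_lim_at_bot p(1) by (rule order_tendstoD)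
  then obtain b where b: "\<And>t. t \<le> b \<Longrightarrow> cdf M t < p" by (auto simp: eventually_at_bot_linorder)
  have bdd: "bdd_below ?Q"
    by (rule bdd_belowI[of _ b]) (metis b linear mem_Collect_eq not_le)
  have "p \<le> cdf M s" if s: "quantile M p < s" for s
  proof -
    obtain t where "t \<in> ?Q" "t < s"
      using s cInf_less_iff[OF ne bdd] by (auto simp: quantile_def)
    then show ?thesis using cdf_nondecreasing[of t s] by auto
  qed
  then have "eventually (\<lambda>s. p \<le> cdf M s) (at_right (quantile M p))"
    by (auto simp: eventually_at_right_field intro: exI[of _ "quantile M p + 1"])
  moreover have "(cdf M \<longlongrightarrow> cdf M (quantile M p)) (at_right (quantile M p))"
    using cdf_is_right_cont by (simp add: continuous_within)
  ultimately show ?thesis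
    by (intro tendsto_lowerbound[OF _ _ trivial_limit_at_right_real])
qed

text \<open>A sum of squares puts no mass on the negative numbers, nor on 0 in the absence of atoms,
  so the distribution function is still 0 at 0. This keeps the threshold positive.\<close>

lemma chi2_quantile_pos:
  assumes n: "0 < n" and p: "0 < p" "p < 1"
  shows "0 < chi2_quantile n p"
proof (rule ccontr)
  interpret real_distribution "chi_squared n" by (rule real_distribution_chi_squared)
  assume "\<not> 0 < chi2_quantile n p"
  then have "cdf (chi_squared n) (chi2_quantile n p) \<le> cdf (chi_squared n) 0"
    by (intro cdf_nondecreasing) simp
  also have "emeasure (chi_squared n) {..0} = emeasure (chi_squared n) {0}"
    unfolding emeasure_chi_squared[OF atMost_borel] emeasure_chi_squared[OF borel_singleton[OF sets.empty_sets]]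
    by (intro nn_integral_cong) (auto simp: indicator_def sum_nonneg intro: antisym)
  then have "cdf (chi_squared n) 0 = 0"
    using chi_squared_no_atom[OF n, of 0] by (simp add: cdf_def measure_def)
  finally show False using le_cdf_quantile[OF p] p by simp
qed

lemma le_measure_chi_squared_below_quantile:
  assumes n: "0 < n" and p: "0 < p" "p < 1"
  shows "p \<le> measure (chi_squared n) {..<chi2_quantile n p}"
proof -
  interpret real_distribution "chi_squared n" by (rule real_distribution_chi_squared)
  let ?q = "chi2_quantile n p"
  have "{..?q} = {..<?q} \<union> {?q}" by auto
  then have "measure (chi_squared n) {..?q} = measure (chi_squared n) {..<?q} + measure (chi_squared n) {?q}"
    by (subst finite_measure_Union[symmetric]) auto
  then show ?thesis
    using le_cdf_quantile[OF p] chi_squared_no_atom[OF n, of ?q] by (simp add: cdf_def measure_def)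
qed

lemma gaussian_vector_norm_prob:
  fixes e :: "'a \<Rightarrow> real^'n"
  assumes M: "prob_space M" and e: "gaussian_vector M e 0 S"
    and t: "t > 0" and bound: "\<And>v. v \<bullet> (S *v v) \<le> t * (norm v)\<^sup>2" and c: "c > 0"
  shows "measure (chi_squared CARD('n)) {..<c\<^sup>2 / t} \<le> measure M {\<omega>\<in>space M. norm (e \<omega>) < c}"
proof -
  have S: "covariance_matrix S" and em: "e \<in> borel_measurable M"
    and law: "\<And>v. distr M borel (\<lambda>\<omega>. v \<bullet> e \<omega>) = normal_law 0 (v \<bullet> (S *v v))"
    using e by (auto simp: gaussian_vector_def)
  obtain B \<mu> where B: "finite B" "card B \<le> CARD('n)" "pairwise orthogonal B"
    "\<And>b. b \<in> B \<Longrightarrow> norm b = 1 \<and> 0 < \<mu> b \<and> b \<in> eigenspace S (\<mu> b)"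
    and SB: "\<And>v. S *v v = (\<Sum>b\<in>B. (\<mu> b * (b \<bullet> v)) *\<^sub>R b)"
    using spectral_decomposition[OF S] by blast
  have \<mu>: "0 < \<mu> b" "\<mu> b \<le> t" if "b \<in> B" for b
    using B(4)[OF that] bound[of b] by (auto simp: eigenspace_def dot_square_norm)
  have "card B \<le> card {..<CARD('n)}" using B(2) by simp
  \<comment> \<open>Each eigenvector receives its own normal coordinate. For singular
    \<open>S\<close> some coordinates are left over; they only increase the chi-squared sum.\<close>
  then obtain h where h: "h ` B \<subseteq> {..<CARD('n)}" "inj_on h B"
    using card_le_inj[OF B(1) finite_lessThan] by blast
  have sum_h: "(\<Sum>i<CARD('n). if i \<in> h ` B then f (inv_into B h i) i else 0) = (\<Sum>b\<in>B. f b (h b))"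
    for f :: "real^'n \<Rightarrow> nat \<Rightarrow> real"
  proof -
    have "(\<Sum>i<CARD('n). if i \<in> h ` B then f (inv_into B h i) i else 0)
        = (\<Sum>i\<in>h ` B. f (inv_into B h i) i)"
      using h(1) by (simp add: sum.If_cases Int_absorb1)
    then show ?thesis using h(2) by (simp add: sum.reindex)
  qed
  let ?\<Gamma> = "PiM {..<CARD('n)} (\<lambda>_. std_normal_distribution)"
  interpret \<Gamma>: prob_space ?\<Gamma> by (rule prob_space_PiM_std_normal)
  have sum_sq_m: "(\<lambda>z. \<Sum>i<CARD('n). (z i)\<^sup>2) \<in> borel_measurable ?\<Gamma>" by measurable
  define Y where "Y z = (\<Sum>b\<in>B. (sqrt (\<mu> b) * z (h b)) *\<^sub>R b)" for z :: "nat \<Rightarrow> real"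
  have hB: "h b \<in> {..<CARD('n)}" if "b \<in> B" for b using h(1) that by blast
  have zm: "(\<lambda>z. z (h b)) \<in> borel_measurable ?\<Gamma>" if "b \<in> B" for b
    using measurable_component_singleton[OF hB[OF that], of "\<lambda>_. std_normal_distribution"] by simp
  have Ym [measurable]: "Y \<in> borel_measurable ?\<Gamma>"
    unfolding Y_def by (intro borel_measurable_sum borel_measurable_scaleR borel_measurable_times
        borel_measurable_const zm)
  have Y_law: "distr ?\<Gamma> borel (\<lambda>z. v \<bullet> Y z) = normal_law 0 (v \<bullet> (S *v v))" for v
  proof (rule \<Gamma>.distr_eq_normal_lawI)
    fix s
    \<comment> \<open>The coefficient of \<open>z i\<close> in \<open>s * (v \<bullet> Y z)\<close>;
      it is 0 for coordinates not assigned to an eigenvector.\<close>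
    define k where "k i = (if i \<in> h ` B then s * sqrt (\<mu> (inv_into B h i)) * (v \<bullet> inv_into B h i) else 0)" for i
    have "s * (v \<bullet> Y z) = (\<Sum>i<CARD('n). k i * z i)" for z
    proof -
      have "(\<Sum>i<CARD('n). k i * z i) = (\<Sum>i<CARD('n). if i \<in> h ` B
          then s * sqrt (\<mu> (inv_into B h i)) * (v \<bullet> inv_into B h i) * z i else 0)"
        by (intro sum.cong) (auto simp: k_def)
      also have "\<dots> = (\<Sum>b\<in>B. s * sqrt (\<mu> b) * (v \<bullet> b) * z (h b))"
        by (rule sum_h)
      also have "\<dots> = s * (v \<bullet> Y z)"
        by (simp add: Y_def inner_sum_right sum_distrib_left ac_simps)
      finally show ?thesis by simp
    qed
    then have "char (distr ?\<Gamma> borel (\<lambda>z. v \<bullet> Y z)) s = (CLINT z|?\<Gamma>. iexp (\<Sum>i<CARD('n). k i * z i))"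
      by (simp add: char_def integral_distr del: of_real_mult of_real_sum)
    also have "\<dots> = complex_of_real (exp (- (\<Sum>i<CARD('n). (k i)\<^sup>2) / 2))"
      by (rule integral_iexp_PiM_std_normal) simp
    also have "(\<Sum>i<CARD('n). (k i)\<^sup>2) = v \<bullet> (S *v v) * s\<^sup>2"
    proof -
      have "(\<Sum>i<CARD('n). (k i)\<^sup>2) = (\<Sum>i<CARD('n). if i \<in> h ` B
          then (s * sqrt (\<mu> (inv_into B h i)) * (v \<bullet> inv_into B h i))\<^sup>2 else 0)"
        by (intro sum.cong) (auto simp: k_def)
      also have "\<dots> = (\<Sum>b\<in>B. (s * sqrt (\<mu> b) * (v \<bullet> b))\<^sup>2)"
        by (rule sum_h)
      also have "\<dots> = (\<Sum>b\<in>B. \<mu> b * (b \<bullet> v) * (v \<bullet> b) * s\<^sup>2)"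
      proof (intro sum.cong refl)
        fix b assume "b \<in> B"
        then show "(s * sqrt (\<mu> b) * (v \<bullet> b))\<^sup>2 = \<mu> b * (b \<bullet> v) * (v \<bullet> b) * s\<^sup>2"
          using \<mu>(1)[of b] by (simp add: power_mult_distrib inner_commute[of b v] power2_eq_square)
      qed
      also have "\<dots> = v \<bullet> (S *v v) * s\<^sup>2"
        by (simp add: SB inner_sum_right sum_distrib_right)
      finally show ?thesis .
    qed
    finally show "char (distr ?\<Gamma> borel (\<lambda>z. v \<bullet> Y z)) s
        = iexp (s * 0) * complex_of_real (exp (- (v \<bullet> (S *v v) * s\<^sup>2) / 2))" by simp
  qed (use covariance_matrix_nonneg[OF S] in auto)
  have norm_Y: "(norm (Y z))\<^sup>2 \<le> t * (\<Sum>i<CARD('n). (z i)\<^sup>2)" for z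
  proof -
    have "(norm (Y z))\<^sup>2 = (\<Sum>b\<in>B. (norm ((sqrt (\<mu> b) * z (h b)) *\<^sub>R b))\<^sup>2)"
      unfolding Y_def using B(1,3)
      by (intro norm_sum_Pythagorean) (auto simp: pairwise_def orthogonal_def)
    also have "\<dots> = (\<Sum>b\<in>B. \<mu> b * (z (h b))\<^sup>2)"
    proof (intro sum.cong refl)
      fix b assume "b \<in> B"
      then show "(norm ((sqrt (\<mu> b) * z (h b)) *\<^sub>R b))\<^sup>2 = \<mu> b * (z (h b))\<^sup>2"
        using B(4)[of b] \<mu>(1)[of b] by (simp add: power_mult_distrib)
    qed
    also have "\<dots> \<le> (\<Sum>b\<in>B. t * (z (h b))\<^sup>2)"
      using \<mu> by (intro sum_mono mult_right_mono) auto
    also have "\<dots> = t * (\<Sum>i\<in>h ` B. (z i)\<^sup>2)"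
      using h(2) by (simp add: sum.reindex sum_distrib_left)
    also have "\<dots> \<le> t * (\<Sum>i<CARD('n). (z i)\<^sup>2)"
      using h(1) t by (intro mult_left_mono sum_mono2) auto
    finally show ?thesis .
  qed
  have "measure (chi_squared CARD('n)) {..<c\<^sup>2 / t}
      = measure ?\<Gamma> ((\<lambda>z. \<Sum>i<CARD('n). (z i)\<^sup>2) -` {..<c\<^sup>2 / t} \<inter> space ?\<Gamma>)"
    unfolding chi_squared_def by (rule measure_distr[OF sum_sq_m]) simp
  also have "\<dots> \<le> measure ?\<Gamma> {z\<in>space ?\<Gamma>. norm (Y z) < c}"
  proof (rule \<Gamma>.finite_measure_mono)
    show "(\<lambda>z. \<Sum>i<CARD('n). (z i)\<^sup>2) -` {..<c\<^sup>2 / t} \<inter> space ?\<Gamma> \<subseteq> {z\<in>space ?\<Gamma>. norm (Y z) < c}"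
    proof safe
      fix z assume "(\<Sum>i<CARD('n). (z i)\<^sup>2) < c\<^sup>2 / t"
      then have "(norm (Y z))\<^sup>2 < c\<^sup>2"
        using norm_Y[of z] t by (simp add: pos_less_divide_eq mult.commute)
      then show "norm (Y z) < c" using c by (simp add: power2_less_imp_less)
    qed
    show "{z\<in>space ?\<Gamma>. norm (Y z) < c} \<in> sets ?\<Gamma>" by measurable
  qed
  \<comment> \<open>\<open>Y\<close> and \<open>e\<close> live on different probability spaces but
    share the laws of all linear functionals.\<close>
  also have "\<dots> = measure M {\<omega>\<in>space M. norm (e \<omega>) < c}"
    by (rule norm_less_prob_eq) (use M em \<Gamma>.prob_space_axioms Ym law Y_law in auto)
  finally show ?thesis .
qed

section \<open>The Info-Greedy run\<close>

lemma gaussian_vector_centered: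
  fixes x :: "'a \<Rightarrow> real^'n"
  assumes "prob_space M" and x: "gaussian_vector M x m S"
  shows "gaussian_vector M (\<lambda>\<omega>. x \<omega> - m) 0 S"
proof -
  interpret prob_space M by fact
  have S: "covariance_matrix S" and xm [measurable]: "x \<in> borel_measurable M"
    and law: "\<And>v. distr M borel (\<lambda>\<omega>. v \<bullet> x \<omega>) = normal_law (v \<bullet> m) (v \<bullet> (S *v v))"
    using x by (auto simp: gaussian_vector_def)
  have "distr M borel (\<lambda>\<omega>. v \<bullet> (x \<omega> - m)) = normal_law 0 (v \<bullet> (S *v v))" for v
  proof (rule distr_eq_normal_lawI)
    fix s
    have "char (distr M borel (\<lambda>\<omega>. v \<bullet> (x \<omega> - m))) s
        = (CLINT \<omega>|M. iexp (- (s * (v \<bullet> m))) * iexp (s * (v \<bullet> x \<omega>)))"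
      by (simp add: char_def integral_distr inner_diff right_diff_distrib flip: exp_add)
    also have "\<dots> = iexp (- (s * (v \<bullet> m))) * char (distr M borel (\<lambda>\<omega>. v \<bullet> x \<omega>)) s"
      by (simp add: char_def integral_distr)
    also have "\<dots> = iexp (s * 0) * complex_of_real (exp (- (v \<bullet> (S *v v) * s\<^sup>2) / 2))"
      using covariance_matrix_nonneg[OF S, of v]
      by (simp add: law char_normal_law exp_minus field_simps)
    finally show "char (distr M borel (\<lambda>\<omega>. v \<bullet> (x \<omega> - m))) s
        = iexp (s * 0) * complex_of_real (exp (- (v \<bullet> (S *v v) * s\<^sup>2) / 2))" .
  qed (use covariance_matrix_nonneg[OF S] in auto)
  then show ?thesis using S by (simp add: gaussian_vector_def)
qed

locale info_greedy_run =
  fixes eigvec :: "nat \<Rightarrow> real^'n^'n \<Rightarrow> real^'n" and eps p sd :: real and S :: "real^'n^'n"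
  assumes S: "covariance_matrix S" and eps: "eps > 0" and p: "0 < p" "p < 1" and sd: "sd > 0"
    and rule: "eigenvector_rule eigvec"
begin

definition threshold :: real where
  "threshold = eps\<^sup>2 / chi2_quantile CARD('n) p"

definition meas_vec :: "nat \<Rightarrow> real^'n^'n \<Rightarrow> real^'n" where
  "meas_vec i A =
    sqrt (measurement_power CARD('n) eps p sd (max_eigenvalue A)) *\<^sub>R eigvec i A"

primrec cov :: "nat \<Rightarrow> real^'n^'n" where
  "cov 0 = S"
| "cov (Suc i) = covariance_update sd (meas_vec i (cov i)) (cov i)"

primrec est :: "(nat \<Rightarrow> real^'n \<Rightarrow> real) \<Rightarrow> real^'n \<Rightarrow> nat \<Rightarrow> real^'n" where
  "est f m 0 = m"
| "est f m (Suc i) = (let a = meas_vec i (cov i) in mean_update sd a (f i a) (est f m i) (cov i))"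

lemma threshold_pos: "0 < threshold"
  using eps chi2_quantile_pos[OF zero_less_card_finite[where ?'a = 'n] p] by (simp add: threshold_def)

lemma measurement_power_eq:
  "measurement_power CARD('n) eps p sd l = (1 / threshold - 1 / l) * sd\<^sup>2"
  by (simp add: measurement_power_def threshold_def)

lemma measurement_power_nonneg:
  "threshold < l \<Longrightarrow> 0 \<le> measurement_power CARD('n) eps p sd l"
  using threshold_pos by (simp add: measurement_power_eq frac_le)

lemma covariance_matrix_cov: "covariance_matrix (cov i)"
  by (induction i) (auto intro: S covariance_matrix_update sd)

lemma funpow_info_greedy_step:
  "(info_greedy_step eigvec eps p sd f ^^ i) (m, S, [])
    = (est f m i, cov i, map (\<lambda>j. meas_vec j (cov j)) [0..<i])"
  by (induction i) (simp_all add: info_greedy_step_def meas_vec_def Let_def)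

text \<open>With \<open>b = (1/t - 1/l) * sd^2\<close> the innovation variance
  \<open>b * l + sd^2\<close> equals \<open>l * sd^2 / t\<close>, so the update subtracts
  \<open>b * l^2 / (b * l + sd^2) = l - t\<close> in the direction \<open>u\<close>.\<close>

lemma deflation_covariance_update:
  assumes A: "covariance_matrix A" and gt: "threshold < max_eigenvalue A"
  shows "deflation A (covariance_update sd (meas_vec i A) A) (eigvec i A) (max_eigenvalue A) threshold"
proof
  define l b where "l = max_eigenvalue A" and "b = measurement_power CARD('n) eps p sd l"
  let ?u = "eigvec i A" and ?t = threshold
  show u: "norm ?u = 1" "?u \<in> eigenspace A (max_eigenvalue A)"
    using rule A by (auto simp: eigenvector_rule_def)
  have l: "?t < l" "0 < l" using gt threshold_pos by (auto simp: l_def)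
  have b: "0 \<le> b" using l measurement_power_nonneg by (simp add: b_def)
  fix v
  have Aa: "A *v meas_vec i A = (sqrt b * l) *\<^sub>R ?u"
    using u by (simp add: meas_vec_def b_def l_def matrix_vector_mult_scaleR eigenspace_def)
  have aAa: "meas_vec i A \<bullet> (A *v meas_vec i A) + sd\<^sup>2 = l / ?t * sd\<^sup>2"
  proof -
    have "meas_vec i A \<bullet> (A *v meas_vec i A) = b * l"
      unfolding Aa using u(1) b by (simp add: meas_vec_def norm_eq_1 flip: b_def l_def)
    also have "\<dots> = l / ?t * sd\<^sup>2 - sd\<^sup>2"
      using l threshold_pos by (simp add: b_def measurement_power_eq field_simps)
    finally show ?thesis by simp
  qed
  have "((A *v meas_vec i A) \<bullet> v) / (l / ?t * sd\<^sup>2) * (sqrt b * l) = (l - ?t) * (?u \<bullet> v)"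
  proof -
    have "((A *v meas_vec i A) \<bullet> v) / (l / ?t * sd\<^sup>2) * (sqrt b * l)
        = (b * l\<^sup>2) / (l / ?t * sd\<^sup>2) * (?u \<bullet> v)"
      unfolding Aa using b by (simp add: power2_eq_square)
    also have "(b * l\<^sup>2) / (l / ?t * sd\<^sup>2) = l - ?t"
      using l threshold_pos sd by (simp add: b_def measurement_power_eq field_simps power2_eq_square)
    finally show ?thesis .
  qed
  then show "covariance_update sd (meas_vec i A) A *v v
      = A *v v - ((max_eigenvalue A - threshold) * (eigvec i A \<bullet> v)) *\<^sub>R eigvec i A"
    unfolding covariance_update_mult_vec[OF A] aAa by (simp add: Aa l_def)
qed (use A gt threshold_pos in auto)

lemma excess_sum_cov:
  assumes "\<And>j. j < i \<Longrightarrow> threshold < max_eigenvalue (cov j)"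
  shows "excess_sum threshold f S
    = excess_sum threshold f (cov i) + (\<Sum>j<i. f (max_eigenvalue (cov j)))"
  using assms
proof (induction i)
  case (Suc i)
  then interpret deflation "cov i" "cov (Suc i)" "eigvec i (cov i)" "max_eigenvalue (cov i)" threshold
    using deflation_covariance_update[OF covariance_matrix_cov] by simp
  show ?case using Suc excess_sum_S'[of f] by simp
qed simp

text \<open>With weight 1 every measurement takes 1 from a fixed finite sum that stays
  non-negative.\<close>

lemma info_greedy_stops: "\<exists>i. \<not> threshold < max_eigenvalue (cov i)"
proof (rule ccontr)
  assume "\<not> ?thesis"
  then have "real i \<le> excess_sum threshold (\<lambda>_. 1) S" for i
    using excess_sum_cov[of i "\<lambda>_. 1"] excess_sum_nonneg[of threshold "\<lambda>_. 1" "cov i"] by simp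
  then show False using reals_Archimedean2 by (metis not_less)
qed

definition num_meas :: nat where
  "num_meas = (LEAST i. \<not> threshold < max_eigenvalue (cov i))"

lemma num_meas: "max_eigenvalue (cov num_meas) \<le> threshold"
  "\<And>j. j < num_meas \<Longrightarrow> threshold < max_eigenvalue (cov j)"
  using LeastI_ex[OF info_greedy_stops] not_less_Least unfolding num_meas_def by force+

text \<open>\<open>while_option\<close> iterates up to the least index at which its guard fails. The
  guard reads only the covariance, so this index is \<open>num_meas\<close> for every outcome
  function \<open>f\<close>.\<close>

lemma info_greedy_eq:
  "info_greedy eigvec eps p sd f m S
    = Some (est f m num_meas, cov num_meas, map (\<lambda>j. meas_vec j (cov j)) [0..<num_meas])"
proof -
  have "(case (info_greedy_step eigvec eps p sd f ^^ i) (m, S, []) of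
      (m, S, as) \<Rightarrow> eps\<^sup>2 / chi2_quantile CARD('n) p < max_eigenvalue S)
      \<longleftrightarrow> threshold < max_eigenvalue (cov i)" for i
    by (simp add: funpow_info_greedy_step threshold_def)
  then show ?thesis
    using info_greedy_stops
    by (simp add: info_greedy_def while_option_def funpow_info_greedy_step num_meas_def)
qed

lemma total_power:
  "(\<Sum>a\<leftarrow>map (\<lambda>j. meas_vec j (cov j)) [0..<num_meas]. (norm a)\<^sup>2)
    \<le> excess_sum threshold (measurement_power CARD('n) eps p sd) S"
proof -
  have "(\<Sum>a\<leftarrow>map (\<lambda>j. meas_vec j (cov j)) [0..<num_meas]. (norm a)\<^sup>2)
      = (\<Sum>j<num_meas. (norm (meas_vec j (cov j)))\<^sup>2)"
    by (simp add: comp_def interv_sum_list_conv_sum_set_nat atLeast0LessThan)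
  also have "\<dots> = (\<Sum>j<num_meas. measurement_power CARD('n) eps p sd (max_eigenvalue (cov j)))"
  proof (intro sum.cong refl)
    fix j assume "j \<in> {..<num_meas}"
    then show "(norm (meas_vec j (cov j)))\<^sup>2 = measurement_power CARD('n) eps p sd (max_eigenvalue (cov j))"
      using rule covariance_matrix_cov[of j] measurement_power_nonneg num_meas(2)[of j]
      by (simp add: meas_vec_def eigenvector_rule_def)
  qed
  also have "\<dots> \<le> excess_sum threshold (measurement_power CARD('n) eps p sd) S"
    using excess_sum_cov[OF num_meas(2)] excess_sum_nonneg[OF measurement_power_nonneg] by simp
  finally show ?thesis .
qed

lemma gaussian_vector_estimation_error:
  fixes x :: "'a \<Rightarrow> real^'n"
  assumes M: "prob_space M" and x: "gaussian_vector M x m S"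
    and w: "\<And>i. distributed M lborel (w i) (normal_density 0 sd)"
    and indep: "independent_signal_noise M x w"
  shows "gaussian_vector M (\<lambda>\<omega>. x \<omega> - est (\<lambda>i a. a \<bullet> x \<omega> + w i \<omega>) m i) 0 (cov i)"
proof -
  interpret prob_space M by fact
  have xm: "x \<in> borel_measurable M" using x by (simp add: gaussian_vector_def)
  have wm: "w i \<in> borel_measurable M" for i
    using distributed_measurable[OF w[of i]] by simp
  have w_law: "distr M borel (w i) = normal_law 0 (sd\<^sup>2)" for i
    using distributed_distr_eq_density[OF w[of i]] sd
    by (simp add: normal_law_def cong: distr_cong)
  let ?e = "\<lambda>i \<omega>. x \<omega> - est (\<lambda>i a. a \<bullet> x \<omega> + w i \<omega>) m i"
  \<comment> \<open>The estimate cancels: the innovation \<open>y - a \<bullet> est\<close> is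
    \<open>a \<bullet> e + w\<close>, so the error satisfies a recursion of its own.\<close>
  have step: "?e (Suc i) \<omega> = ?e i \<omega> - ((a \<bullet> ?e i \<omega> + w i \<omega>) / (a \<bullet> (cov i *v a) + sd\<^sup>2)) *\<^sub>R (cov i *v a)"
    if "a = meas_vec i (cov i)" for i \<omega> a
    by (simp add: Let_def mean_update_def that inner_diff algebra_simps)
  \<comment> \<open>Only noises with index below \<open>i\<close> enter the error after
    \<open>i\<close> measurements, which makes it independent of the next noise
    \<open>w i\<close>.\<close>
  have aff: "\<exists>d q c. \<forall>\<omega>. v \<bullet> ?e i \<omega> = d + q \<bullet> x \<omega> + (\<Sum>j<i. c j * w j \<omega>)" for v i
  proof (induction i arbitrary: v)
    case 0
    show ?case
      by (intro exI[of _ "- (v \<bullet> m)"] exI[of _ v]) (simp add: inner_diff)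
  next
    case (Suc i)
    define a where "a = meas_vec i (cov i)"
    define r where "r = (v \<bullet> (cov i *v a)) / (a \<bullet> (cov i *v a) + sd\<^sup>2)"
    obtain d q c where "\<And>\<omega>. (v - r *\<^sub>R a) \<bullet> ?e i \<omega> = d + q \<bullet> x \<omega> + (\<Sum>j<i. c j * w j \<omega>)"
      using Suc.IH by metis
    moreover have "v \<bullet> ?e (Suc i) \<omega> = (v - r *\<^sub>R a) \<bullet> ?e i \<omega> - r * w i \<omega>" for \<omega>
      unfolding step[OF a_def] inner_diff_right[of v "?e i \<omega>"]
      by (simp add: r_def inner_diff_left add_divide_distrib distrib_left mult.commute)
    \<comment> \<open>The new noise \<open>w i\<close> enters with coefficient \<open>- r\<close>;
      the earlier coefficients are those belonging to the functional \<open>v - r a\<close>.\<close>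
    ultimately have "\<forall>\<omega>. v \<bullet> ?e (Suc i) \<omega> = d + q \<bullet> x \<omega> + (\<Sum>j<Suc i. (c(i := - r)) j * w j \<omega>)"
      by (simp add: algebra_simps)
    then show ?case by blast
  qed
  show ?thesis
  proof (induction i)
    case 0
    show ?case using gaussian_vector_centered[OF M x] by simp
  next
    case (Suc i)
    have "indep_var borel (w i) borel (\<lambda>\<omega>. v \<bullet> ?e i \<omega>)" for v
      using aff[of v i] indep_affine_combination[OF xm wm indep] by auto
    from gaussian_vector_measurement_error[OF Suc.IH sd w_law this, of "meas_vec i (cov i)"]
    show ?case unfolding step[OF refl] by simp
  qed
qed

end

theorem mainTheorem6:
  fixes M :: "'a measure"
    and x :: "'a \<Rightarrow> real^'n" and m :: "real^'n" and S :: "real^'n^'n"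
    and w :: "nat \<Rightarrow> 'a \<Rightarrow> real"
    and eigvec :: "nat \<Rightarrow> real^'n^'n \<Rightarrow> real^'n"
    and k :: nat and lam :: "nat \<Rightarrow> real"
    and eps p sd :: real
  assumes "prob_space M"
    and "gaussian_vector M x m S"
    and "rank S = k"
    and "nonzero_eigenvalue_list S k lam"
    and "eps > 0" and "0 < p" and "p < 1" and "sd > 0"
    and "\<And>i. distributed M lborel (w i) (normal_density 0 sd)"
    and "independent_signal_noise M x w"
    and "eigenvector_rule eigvec"
  shows "\<exists>xhat Sfin as.
      (\<forall>\<omega>\<in>space M.
         info_greedy eigvec eps p sd (\<lambda>i a. a \<bullet> x \<omega> + w i \<omega>) m S
           = Some (xhat \<omega>, Sfin \<omega>, as \<omega>)) \<and>
      {\<omega>\<in>space M. norm (x \<omega> - xhat \<omega>) < eps} \<in> sets M \<and>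
      measure M {\<omega>\<in>space M. norm (x \<omega> - xhat \<omega>) < eps} \<ge> p \<and>
      (\<forall>\<omega>\<in>space M.
         (\<Sum>a\<leftarrow>as \<omega>. (norm a)\<^sup>2) \<le>
           (\<Sum>i\<in>{i\<in>{1..k}. lam i \<noteq> 0}.
              max 0 ((chi2_quantile CARD('n) p / eps\<^sup>2 - 1 / lam i) * sd\<^sup>2)))"
proof -
  have S: "covariance_matrix S" using assms(2) by (simp add: gaussian_vector_def)
  interpret info_greedy_run eigvec eps p sd S
    by standard (use assms S in auto)
  let ?xhat = "\<lambda>\<omega>. est (\<lambda>i a. a \<bullet> x \<omega> + w i \<omega>) m num_meas"
  have e: "gaussian_vector M (\<lambda>\<omega>. x \<omega> - ?xhat \<omega>) 0 (cov num_meas)"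
    using assms by (intro gaussian_vector_estimation_error) auto
  then have [measurable]: "(\<lambda>\<omega>. x \<omega> - ?xhat \<omega>) \<in> borel_measurable M"
    by (simp add: gaussian_vector_def)
  have "v \<bullet> (cov num_meas *v v) \<le> threshold * (norm v)\<^sup>2" for v
    by (rule order_trans[OF quadratic_form_le_max_eigenvalue[OF covariance_matrix_cov]])
      (simp add: mult_right_mono num_meas(1))
  from gaussian_vector_norm_prob[OF \<open>prob_space M\<close> e threshold_pos this eps]
  \<comment> \<open>The radius was matched to the threshold: \<open>eps^2 / threshold\<close> is the
    quantile itself.\<close>
  have "measure (chi_squared CARD('n)) {..<chi2_quantile CARD('n) p}
      \<le> measure M {\<omega>\<in>space M. norm (x \<omega> - ?xhat \<omega>) < eps}"
    using eps by (simp add: threshold_def)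
  then have prob: "p \<le> measure M {\<omega>\<in>space M. norm (x \<omega> - ?xhat \<omega>) < eps}"
    using le_measure_chi_squared_below_quantile[OF zero_less_card_finite p] by (rule order_trans[rotated])
  \<comment> \<open>Above the threshold the power is at most its positive part; the maximum with 0
    supplies the non-negativity required at the remaining eigenvalues.\<close>
  have "excess_sum threshold (measurement_power CARD('n) eps p sd) S
      \<le> (\<Sum>i\<in>{i\<in>{1..k}. lam i \<noteq> 0}. max 0 ((chi2_quantile CARD('n) p / eps\<^sup>2 - 1 / lam i) * sd\<^sup>2))"
    by (rule excess_sum_le_eigenvalue_list[OF S assms(4)])
      (use threshold_pos in \<open>auto simp: measurement_power_def less_imp_le\<close>)
  with total_power have power: "(\<Sum>a\<leftarrow>map (\<lambda>j. meas_vec j (cov j)) [0..<num_meas]. (norm a)\<^sup>2)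
      \<le> (\<Sum>i\<in>{i\<in>{1..k}. lam i \<noteq> 0}. max 0 ((chi2_quantile CARD('n) p / eps\<^sup>2 - 1 / lam i) * sd\<^sup>2))"
    by (rule order_trans)
  show ?thesis
  proof (intro exI conjI ballI)
    show "info_greedy eigvec eps p sd (\<lambda>i a. a \<bullet> x \<omega> + w i \<omega>) m S
        = Some (?xhat \<omega>, cov num_meas, map (\<lambda>j. meas_vec j (cov j)) [0..<num_meas])" for \<omega>
      by (rule info_greedy_eq)
    show "{\<omega>\<in>space M. norm (x \<omega> - ?xhat \<omega>) < eps} \<in> sets M" by measurable
  qed (use prob power in auto)
qed

end
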